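(* The permutation defect fusion ring $(C^\times_{S_n},\otimes)$ is a unital based $\mathbb{Z}_+$-ring (with respect to the basis consisting of the multilayer anyons $\vec a$ and the defects $X^\sigma_{\vec a}$) which is $S_n$-crossed commutative, i.e. $X^\rho_{\vec a}\otimes Y=\rho\cdot Y\otimes X^\rho_{\vec a}$ for all $\rho\in S_n$, all basis elements $X^\rho_{\vec a}\in C_\rho$ and all $Y\in C^\times_{S_n}$.
   Context: Let $\mathcal{C}$ be a modular tensor category, $\mathrm{Irr}(\mathcal{C})$ its finite set of isomorphism classes of simple objects (containing $1$), $a\mapsto a^*$ duality, $N_{ab}^c$ fusion coefficients, and $C$ its fusion ring (free $\mathbb{Z}$-module on $\mathrm{Irr}(\mathcal{C})$, product $a\otimes b=\sum_cN_{ab}^cc$). Fix $n\ge 2$. $C^{\boxtimes n}=C^{\otimes_{\mathbb{Z}}n}$ has basis the multilayer anyons $\vec a=a_1\boxtimes\cdots\boxtimes a_n$ ($a_i\in\mathrm{Irr}(\mathcal{C})$, the entry of layer $i$), layerwise product, unit $\vec 1$. $S_n$ acts by permuting layers ($\rho$ moves layer $i$ to layer $\rho(i)$); permutations compose right to left. For $\sigma\in S_n$ let $\mathcal{O}(\sigma)$ be its orbits (cycles incl. fixed points); $\vec a$ is $\sigma$-fixed iff $a_i=a_j$ whenever $i,j$ share an orbit. $C_\sigma$ is the free $\mathbb{Z}$-module on symbols $X^\sigma_{\vec a}$ ($\vec a$ $\sigma$-fixed), identified with $R_\sigma=\bigotimes_{O\in\mathcal{O}(\sigma)}C$ via $X^\sigma_{\vec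 a}\leftrightarrow\bigotimes_Oa_O$; write $X^\sigma_r$ for $r\in R_\sigma$. $C_{\mathrm{id}}=C^{\boxtimes n}$, $X^{\mathrm{id}}_{\vec a}=\vec a$, $C^\times_{S_n}=\bigoplus_\sigma C_\sigma$. $S_n$ acts on $C^\times_{S_n}$ by $\rho\cdot X^\sigma_{\vec a}=X^{\rho\sigma\rho^{-1}}_{\rho\cdot\vec a}$. Confinement: $c_\sigma:C^{\boxtimes n}\to R_\sigma$ linear with $c_\sigma(\vec a)=\bigotimes_O(\bigotimes_{k\in O}a_k)$. Anyon–defect fusion: $\vec a\otimes X^\sigma_{\vec b}=X^\sigma_{\vec b}\otimes\vec a:=X^\sigma_{c_\sigma(\vec a)\cdot\vec b}$. A $\sigma$-deconfinement $d_\sigma(\vec b)$ is any $d\in C^{\boxtimes n}$ with nonnegative coefficients and $d\otimes X^\sigma_{\vec 1}=X^\sigma_{\vec b}$. For a transposition $t=(ij)$, $\Omega_t=\sum_{c\in\mathrm{Irr}(\mathcal{C})}\vec e_c$ with $\vec e_c$ having $c$ in layer $i$, $c^*$ in layer $j$, $1$ elsewhere. Following the paper's algorithm, $F(\rho,\sigma)$: write $\rho=t_1\cdots t_m$ with each disjoint cycle $(i_1\cdots i_l)$ of $\rho$ written as $(i_1i_2)(i_2i_3)\cdots(i_{l-1}i_l)$; $\pi_{m+1}=\sigma$, $\pi_k=t_k\pi_{k+1}$; $F(\rho,\sigma)=\prod\Omega_{t_k}$ over $k$ with both indices of $t_k$ in a common cycle of $\pi_{k+1}$. The product $\otimes$ on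 $C^\times_{S_n}$ is bilinear with $X^\rho_{\vec a}\otimes X^\sigma_{\vec b}:=(d_\rho(\vec a)\otimes d_\sigma(\vec b)\otimes F(\rho,\sigma))\otimes X^{\rho\sigma}_{\vec 1}$. A unital based $\mathbb{Z}_+$-ring is a ring, free as $\mathbb{Z}$-module, with a fixed basis $\{b_i\}_{i\in I}$ such that $b_ib_j=\sum_kN_{ij}^kb_k$ with $N_{ij}^k\in\mathbb{Z}_{\ge0}$, $1$ is a basis element, and there is an involution $i\mapsto i^*$ of $I$ inducing an anti-involution of the ring such that the coefficient of $1$ in $b_ib_j$ is $1$ if $i=j^*$ and $0$ otherwise. *)

theory Defs
  imports "HOL-Combinatorics.Permutations"
begin

text \<open>Only the fusion ring of the MTC C enters the statement. We record it as the set Irr of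
  (isomorphism classes of) simple objects, the unit, duality and the fusion coefficients.\<close>

record 'a fusion_data =
  Irr :: "'a set"
  unit :: 'a
  dual :: "'a \<Rightarrow> 'a"
  Nf :: "'a \<Rightarrow> 'a \<Rightarrow> 'a \<Rightarrow> nat"

definition mtc_fusion_rules :: "'a fusion_data \<Rightarrow> bool" where
  "mtc_fusion_rules C \<longleftrightarrow>
     finite (Irr C) \<and> unit C \<in> Irr C \<and>
     (\<forall>a\<in>Irr C. dual C a \<in> Irr C \<and> dual C (dual C a) = a) \<and>
     (\<forall>a\<in>Irr C. \<forall>c\<in>Irr C. Nf C (unit C) a c = (if a = c then 1 else 0)
                          \<and> Nf C a (unit C) c = (if a = c then 1 else 0)) \<and>
     (\<forall>a\<in>Irr C. \<forall>b\<in>Irr C. \<forall>c\<in>Irr C. Nf C a b c = Nf C b a c) \<and>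
     (\<forall>a\<in>Irr C. \<forall>b\<in>Irr C. \<forall>c\<in>Irr C. \<forall>d\<in>Irr C.
        (\<Sum>e\<in>Irr C. Nf C a b e * Nf C e c d) = (\<Sum>e\<in>Irr C. Nf C b c e * Nf C a e d)) \<and>
     (\<forall>a\<in>Irr C. \<forall>b\<in>Irr C. Nf C a b (unit C) = (if b = dual C a then 1 else 0)) \<and>
     (\<forall>a\<in>Irr C. \<forall>b\<in>Irr C. \<forall>c\<in>Irr C. Nf C a b c = Nf C (dual C b) (dual C a) (dual C c))"

text \<open>Layers are 0,...,n-1. A multilayer anyon is a function nat => 'a with entries in Irr
  on layers < n and equal to the unit on all other indices. Elements of C^{\<boxtimes>n} are
  integer-valued functions on multilayer anyons (zero outside).\<close>

definition anyons :: "'a fusion_data \<Rightarrow> nat \<Rightarrow> (nat \<Rightarrow> 'a) set" where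
  "anyons C n = {a. (\<forall>i<n. a i \<in> Irr C) \<and> (\<forall>i\<ge>n. a i = unit C)}"


definition tunit :: "'a fusion_data \<Rightarrow> ((nat \<Rightarrow> 'a) \<Rightarrow> int)" where
  "tunit C = (\<lambda>a. if a = (\<lambda>_. unit C) then 1 else 0)"

definition tprod :: "'a fusion_data \<Rightarrow> nat \<Rightarrow> ((nat \<Rightarrow> 'a) \<Rightarrow> int) \<Rightarrow> ((nat \<Rightarrow> 'a) \<Rightarrow> int)
                      \<Rightarrow> ((nat \<Rightarrow> 'a) \<Rightarrow> int)" where
  "tprod C n x y = (\<lambda>c. if c \<in> anyons C n then
      (\<Sum>a\<in>anyons C n. \<Sum>b\<in>anyons C n. x a * y b * (\<Prod>i<n. int (Nf C (a i) (b i) (c i))))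
      else 0)"

definition perms :: "nat \<Rightarrow> (nat \<Rightarrow> nat) set" where
  "perms n = {p. p permutes {..<n}}"

definition orbit_of :: "(nat \<Rightarrow> nat) \<Rightarrow> nat \<Rightarrow> nat set" where
  "orbit_of p i = {(p ^^ k) i | k. True}"

definition orbits :: "nat \<Rightarrow> (nat \<Rightarrow> nat) \<Rightarrow> nat set set" where
  "orbits n p = orbit_of p ` {..<n}"

definition fixed_by :: "nat \<Rightarrow> (nat \<Rightarrow> nat) \<Rightarrow> (nat \<Rightarrow> 'a) \<Rightarrow> bool" where
  "fixed_by n p a \<longleftrightarrow> (\<forall>Q\<in>orbits n p. \<forall>i\<in>Q. \<forall>j\<in>Q. a i = a j)"

definition act_anyon :: "(nat \<Rightarrow> nat) \<Rightarrow> (nat \<Rightarrow> 'a) \<Rightarrow> (nat \<Rightarrow> 'a)" where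
  "act_anyon r a = a \<circ> inv r"

fun Nlist :: "'a fusion_data \<Rightarrow> 'a list \<Rightarrow> 'a \<Rightarrow> nat" where
  "Nlist C [] c = (if c = unit C then 1 else 0)"
| "Nlist C (x # xs) c = (\<Sum>e\<in>Irr C. Nf C x e c * Nlist C xs e)"

text \<open>R_sigma is identified with the span of sigma-fixed anyons (X^sigma_b <-> tensor_O b_O).
  conf C n p a b is the coefficient of X^p_b in c_p(a).\<close>
definition conf :: "'a fusion_data \<Rightarrow> nat \<Rightarrow> (nat \<Rightarrow> nat) \<Rightarrow> (nat \<Rightarrow> 'a) \<Rightarrow> (nat \<Rightarrow> 'a) \<Rightarrow> int" where
  "conf C n p a b = (\<Prod>Q\<in>orbits n p. int (Nlist C (map a (sorted_list_of_set Q)) (b (Min Q))))"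

definition conf_elem :: "'a fusion_data \<Rightarrow> nat \<Rightarrow> (nat \<Rightarrow> nat) \<Rightarrow> ((nat \<Rightarrow> 'a) \<Rightarrow> int)
                         \<Rightarrow> ((nat \<Rightarrow> 'a) \<Rightarrow> int)" where
  "conf_elem C n p x = (\<lambda>b. if b \<in> anyons C n \<and> fixed_by n p b
                            then (\<Sum>a\<in>anyons C n. x a * conf C n p a b) else 0)"

text \<open>d is a p-deconfinement of b: nonnegative coefficients and d \<otimes> X^p_1 = X^p_b,
  i.e. c_p(d) = b (since d \<otimes> X^p_1 = X^p_{c_p(d)}).\<close>
definition is_deconf :: "'a fusion_data \<Rightarrow> nat \<Rightarrow> (nat \<Rightarrow> nat) \<Rightarrow> (nat \<Rightarrow> 'a)
                         \<Rightarrow> ((nat \<Rightarrow> 'a) \<Rightarrow> int) \<Rightarrow> bool" where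
  "is_deconf C n p b d \<longleftrightarrow> (\<forall>a. d a \<noteq> 0 \<longrightarrow> a \<in> anyons C n) \<and> (\<forall>a. 0 \<le> d a) \<and>
      conf_elem C n p d = (\<lambda>c. if c = b then 1 else 0)"

definition deconf :: "'a fusion_data \<Rightarrow> nat \<Rightarrow> (nat \<Rightarrow> nat) \<Rightarrow> (nat \<Rightarrow> 'a) \<Rightarrow> ((nat \<Rightarrow> 'a) \<Rightarrow> int)" where
  "deconf C n p b = (SOME d. is_deconf C n p b d)"

definition transp :: "nat \<Rightarrow> nat \<Rightarrow> nat \<Rightarrow> nat" where
  "transp i j = (\<lambda>k. if k = i then j else if k = j then i else k)"

definition Omega :: "'a fusion_data \<Rightarrow> nat \<Rightarrow> nat \<Rightarrow> nat \<Rightarrow> ((nat \<Rightarrow> 'a) \<Rightarrow> int)" where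
  "Omega C n i j = (\<lambda>a. if a \<in> anyons C n \<and>
      (\<exists>c\<in>Irr C. a = (\<lambda>k. if k = i then c else if k = j then dual C c else unit C)) then 1 else 0)"

definition cycle_transps :: "(nat \<Rightarrow> nat) \<Rightarrow> nat \<Rightarrow> (nat \<times> nat) list" where
  "cycle_transps r m = map (\<lambda>k. ((r ^^ k) m, (r ^^ (Suc k)) m)) [0..<card (orbit_of r m) - 1]"

text \<open>Decomposition rho = t_1 ... t_m: cycles ordered by increasing minimal element, each cycle
  starting at its minimal element.\<close>
definition transp_decomp :: "nat \<Rightarrow> (nat \<Rightarrow> nat) \<Rightarrow> (nat \<times> nat) list" where
  "transp_decomp n r = concat (map (cycle_transps r)
       (sorted_list_of_set {m. m < n \<and> m = Min (orbit_of r m)}))"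

definition pi_after :: "(nat \<times> nat) list \<Rightarrow> (nat \<Rightarrow> nat) \<Rightarrow> (nat \<Rightarrow> nat)" where
  "pi_after ts s = foldr (\<lambda>t p. transp (fst t) (snd t) \<circ> p) ts s"

fun Fprod :: "'a fusion_data \<Rightarrow> nat \<Rightarrow> (nat \<times> nat) list \<Rightarrow> (nat \<Rightarrow> nat) \<Rightarrow> ((nat \<Rightarrow> 'a) \<Rightarrow> int)" where
  "Fprod C n [] s = tunit C"
| "Fprod C n (t # ts) s =
     tprod C n (if snd t \<in> orbit_of (pi_after ts s) (fst t) then Omega C n (fst t) (snd t) else tunit C)
               (Fprod C n ts s)"

definition Fmap :: "'a fusion_data \<Rightarrow> nat \<Rightarrow> (nat \<Rightarrow> nat) \<Rightarrow> (nat \<Rightarrow> nat) \<Rightarrow> ((nat \<Rightarrow> 'a) \<Rightarrow> int)" where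
  "Fmap C n r s = Fprod C n (transp_decomp n r) s"

text \<open>Basis: pairs (sigma, a) standing for X^sigma_a, a sigma-fixed (sigma = id gives the
  multilayer anyons).\<close>
definition dbasis :: "'a fusion_data \<Rightarrow> nat \<Rightarrow> ((nat \<Rightarrow> nat) \<times> (nat \<Rightarrow> 'a)) set" where
  "dbasis C n = {(p, a). p \<in> perms n \<and> a \<in> anyons C n \<and> fixed_by n p a}"

text \<open>Structure constants: coefficient of X^tau_c in X^rho_a \<otimes> X^sigma_b
  = (d_rho(a) \<otimes> d_sigma(b) \<otimes> F(rho,sigma)) \<otimes> X^(rho sigma)_1 = X^(rho sigma)_(c_(rho sigma)(...)).\<close>
definition dN :: "'a fusion_data \<Rightarrow> nat \<Rightarrow> ((nat \<Rightarrow> nat) \<times> (nat \<Rightarrow> 'a)) \<Rightarrow> ((nat \<Rightarrow> nat) \<times> (nat \<Rightarrow> 'a))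
                 \<Rightarrow> ((nat \<Rightarrow> nat) \<times> (nat \<Rightarrow> 'a)) \<Rightarrow> int" where
  "dN C n x y z = (case x of (r, a) \<Rightarrow> case y of (s, b) \<Rightarrow> case z of (t, c) \<Rightarrow>
      if t = r \<circ> s then
        conf_elem C n (r \<circ> s)
          (tprod C n (tprod C n (deconf C n r a) (deconf C n s b)) (Fmap C n r s)) c
      else 0)"

definition dunit :: "'a fusion_data \<Rightarrow> ((nat \<Rightarrow> nat) \<times> (nat \<Rightarrow> 'a))" where
  "dunit C = (id, (\<lambda>_. unit C))"

text \<open>Action of S_n on C^x_{S_n}: rho . X^sigma_a = X^(rho sigma rho^-1)_(rho . a).\<close>
definition act_elem :: "(nat \<Rightarrow> nat) \<Rightarrow> (((nat \<Rightarrow> nat) \<times> (nat \<Rightarrow> 'a)) \<Rightarrow> int)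
                        \<Rightarrow> (((nat \<Rightarrow> nat) \<times> (nat \<Rightarrow> 'a)) \<Rightarrow> int)" where
  "act_elem r Y = (\<lambda>(t, c). Y (inv r \<circ> t \<circ> r, c \<circ> r))"

text \<open>Ring elements: finitely supported integer functions on the basis B; product is the bilinear
  extension of the structure constants N.\<close>
definition bmult :: "'b set \<Rightarrow> ('b \<Rightarrow> 'b \<Rightarrow> 'b \<Rightarrow> int) \<Rightarrow> ('b \<Rightarrow> int) \<Rightarrow> ('b \<Rightarrow> int) \<Rightarrow> ('b \<Rightarrow> int)" where
  "bmult B N x y = (\<lambda>k. if k \<in> B then
      (\<Sum>i\<in>{i\<in>B. x i \<noteq> 0}. \<Sum>j\<in>{j\<in>B. y j \<noteq> 0}. x i * y j * N i j k) else 0)"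

definition basis_elem :: "'b \<Rightarrow> ('b \<Rightarrow> int)" where
  "basis_elem i = (\<lambda>k. if k = i then 1 else 0)"

definition unital_based_Zplus_ring :: "'b set \<Rightarrow> ('b \<Rightarrow> 'b \<Rightarrow> 'b \<Rightarrow> int) \<Rightarrow> 'b \<Rightarrow> bool" where
  "unital_based_Zplus_ring B N u \<longleftrightarrow>
     (\<forall>i\<in>B. \<forall>j\<in>B. finite {k\<in>B. N i j k \<noteq> 0}) \<and>
     (\<forall>i\<in>B. \<forall>j\<in>B. \<forall>k\<in>B. 0 \<le> N i j k) \<and>
     (\<forall>i\<in>B. \<forall>j\<in>B. \<forall>k\<in>B. \<forall>m\<in>B.
        (\<Sum>l\<in>{l\<in>B. N i j l \<noteq> 0}. N i j l * N l k m) = (\<Sum>l\<in>{l\<in>B. N j k l \<noteq> 0}. N j k l * N i l m)) \<and>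
     u \<in> B \<and>
     (\<forall>i\<in>B. \<forall>k\<in>B. N u i k = (if i = k then 1 else 0) \<and> N i u k = (if i = k then 1 else 0)) \<and>
     (\<exists>inv. (\<forall>i\<in>B. inv i \<in> B \<and> inv (inv i) = i) \<and>
        (\<forall>i\<in>B. \<forall>j\<in>B. \<forall>k\<in>B. N i j (inv k) = N (inv j) (inv i) k) \<and>
        (\<forall>i\<in>B. \<forall>j\<in>B. N i j u = (if i = inv j then 1 else 0)))"

end

theory Submission
  imports Defs "HOL-Combinatorics.Cycles" "HOL-Library.FuncSet"
    "HOL-Computational_Algebra.Fundamental_Theorem_Algebra"
begin

text \<open>The fusion ring is diagonalised by its characters: these are pairwise orthogonal, and they are
  complete, because a nonzero vector orthogonal to all of them would produce a common eigenvector of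
  all fusion matrices, that is, a further character. An element of \<open>C\<^sup>\<otimes>\<^sup>n\<close> thus becomes a function on the
  labelings \<open>s\<close> of the layers by characters, its confinement along \<open>\<sigma>\<close> is the restriction to the
  \<open>\<sigma>\<close>-invariant labelings, and \<open>\<Omega>\<close> for layers \<open>i, j\<close> is supported on the labelings with \<open>s i = s j\<close>,
  where it takes the value \<open>\<kappa>\<^sup>-\<^sup>2\<close>, with \<open>\<kappa>\<close> the inverse norm of the character \<open>s i\<close>. Let \<open>w\<^sub>\<sigma>\<close> be the product of
  \<open>\<kappa>\<close> over the orbits of \<open>\<sigma>\<close>. Multiplying by a transposition merges two orbits or splits one, so on
  labelings invariant under \<open>\<rho>\<sigma>\<close> the factor \<open>F(\<rho>,\<sigma>)\<close> equals \<open>w\<^sub>\<rho> w\<^sub>\<sigma> / (w\<^sub>i\<^sub>d w\<^sub>\<rho>\<^sub>\<sigma>)\<close> if the labeling is invariant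
  under \<open>\<rho>\<close> and \<open>\<sigma>\<close>, and vanishes otherwise. Rescaled by \<open>w\<^sub>\<sigma> / w\<^sub>i\<^sub>d\<close> and extended by zero, the basis
  elements therefore multiply pointwise, and all ring axioms can be read off.\<close>

section \<open>Orbits of permutations\<close>

lemma orbit_of_self [simp]: "i \<in> orbit_of p i"
  unfolding orbit_of_def by (metis (mono_tags, lifting) funpow_0 mem_Collect_eq)

lemma orbit_of_funpow: "(p ^^ k) i \<in> orbit_of p i"
  unfolding orbit_of_def by blast

lemma orbit_of_trans: "x \<in> orbit_of p y \<Longrightarrow> y \<in> orbit_of p i \<Longrightarrow> x \<in> orbit_of p i"
  unfolding orbit_of_def by clarsimp (metis comp_apply funpow_add)

lemma orbit_of_step: "x \<in> orbit_of p i \<Longrightarrow> p x \<in> orbit_of p i"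
  by (metis funpow_0 funpow.simps(2) comp_apply orbit_of_funpow orbit_of_trans)

lemma orbit_of_subset:
  assumes "i \<in> A" "\<And>x. x \<in> A \<Longrightarrow> p x \<in> A"
  shows "orbit_of p i \<subseteq> A"
proof -
  have "(p ^^ k) i \<in> A" for k by (induction k) (use assms in auto)
  then show ?thesis by (auto simp: orbit_of_def)
qed

lemma invariant_on_orbit:
  assumes "\<And>i. s (p i) = s i" "x \<in> orbit_of p i"
  shows "s x = s i"
  using orbit_of_subset[of i "{x. s x = s i}" p] assms by auto

lemma permutes_funpow_period:
  fixes n :: nat
  assumes "p permutes {..<n}"
  obtains l where "l > 0" "(p ^^ l) i = i"
  using assms least_power_of_permutation permutation_permutes by (metis finite_lessThan)

text \<open>\<open>orbit_of\<close> collects forward iterates only, so symmetry rests on finite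
  order: \<open>l * k\<close> steps lead from \<open>i\<close> back to \<open>i\<close>, the first
  \<open>k\<close> of them lead to \<open>x\<close>, and the remaining \<open>l * k - k\<close>
  therefore lead from \<open>x\<close> to \<open>i\<close>.\<close>

lemma orbit_of_sym:
  fixes n :: nat
  assumes "p permutes {..<n}" "x \<in> orbit_of p i"
  shows "i \<in> orbit_of p x"
proof -
  obtain k where k: "x = (p ^^ k) i" using assms(2) by (auto simp: orbit_of_def)
  obtain l where l: "l > 0" "(p ^^ l) i = i" using permutes_funpow_period[OF assms(1)] .
  have lm: "(p ^^ (l * m)) i = i" for m
    by (induction m) (use l in \<open>auto simp: funpow_add\<close>)
  have "k \<le> l * k" using l by simp
  then have "(p ^^ (l * k - k)) x = i"
    unfolding k using lm[of k] by (metis comp_apply funpow_add le_add_diff_inverse2)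
  then show ?thesis by (auto simp: orbit_of_def)
qed

lemma orbit_of_eq:
  fixes n :: nat
  assumes "p permutes {..<n}" "x \<in> orbit_of p i"
  shows "orbit_of p x = orbit_of p i"
  using assms orbit_of_sym orbit_of_trans by blast

lemma orbit_of_bounded:
  assumes "p permutes {..<n}" "i < n"
  shows "orbit_of p i \<subseteq> {..<n}"
  by (rule orbit_of_subset) (use assms permutes_in_image[OF assms(1)] in auto)

lemma orbit_of_fixpoint: "p i = i \<Longrightarrow> orbit_of p i = {i}"
  using orbit_of_subset[of i "{i}" p] by auto

lemma orbits_id: "orbits n id = (\<lambda>i. {i}) ` {..<n}"
  by (auto simp: orbits_def orbit_of_fixpoint)

context
  fixes p :: "nat \<Rightarrow> nat" and n :: nat
  assumes p: "p permutes {..<n}"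
begin

lemma finite_orbits [simp]: "finite (orbits n p)"
  by (simp add: orbits_def)

lemma orbit_eq_orbit_of: "Q \<in> orbits n p \<Longrightarrow> i \<in> Q \<Longrightarrow> Q = orbit_of p i"
  by (auto simp: orbits_def orbit_of_eq[OF p])

lemma orbit_in_orbits: "i < n \<Longrightarrow> orbit_of p i \<in> orbits n p"
  by (simp add: orbits_def)

lemma orbit_finite: "Q \<in> orbits n p \<Longrightarrow> finite Q"
  using orbit_of_bounded[OF p] by (auto simp: orbits_def intro: finite_subset)

lemma orbit_Min_in: "Q \<in> orbits n p \<Longrightarrow> Min Q \<in> Q"
  by (rule Min_in) (auto simp: orbit_finite orbits_def, metis empty_iff orbit_of_self)

lemma orbit_less: "Q \<in> orbits n p \<Longrightarrow> i \<in> Q \<Longrightarrow> i < n"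
  using orbit_of_bounded[OF p] by (auto simp: orbits_def)

lemma orbits_disjoint: "Q \<in> orbits n p \<Longrightarrow> R \<in> orbits n p \<Longrightarrow> Q \<noteq> R \<Longrightarrow> Q \<inter> R = {}"
  using orbit_eq_orbit_of by blast

lemma Union_orbits: "\<Union> (orbits n p) = {..<n}"
  using orbit_of_bounded[OF p] orbit_of_self by (fastforce simp: orbits_def)

lemma prod_over_orbits: "prod g {..<n} = (\<Prod>Q\<in>orbits n p. prod g Q)"
  using prod.Union_disjoint[of "orbits n p" g] orbits_disjoint orbit_finite
  by (auto simp: Union_orbits)

text \<open>Orbits that share a point coincide, so a family of orbits that covers all layers already
  contains every orbit. This criterion identifies the orbits after multiplication by a
  transposition.\<close>

lemma orbits_partition:
  assumes "\<And>i. i < n \<Longrightarrow> \<exists>Q\<in>P. i \<in> Q" "\<And>Q. Q \<in> P \<Longrightarrow> \<exists>i<n. Q = orbit_of p i"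
  shows "orbits n p = P"
proof
  show "P \<subseteq> orbits n p" using assms(2) orbit_in_orbits by blast
  show "orbits n p \<subseteq> P"
  proof
    fix Q assume Q: "Q \<in> orbits n p"
    then obtain i where i: "i < n" "Q = orbit_of p i" by (auto simp: orbits_def)
    then obtain R where R: "R \<in> P" "i \<in> R" using assms(1) by blast
    then have "R = orbit_of p i" using assms(2) orbit_of_eq[OF p] by metis
    then show "Q \<in> P" using R i by simp
  qed
qed

end

section \<open>Multiplication by a transposition: orbits and orbit weights\<close>

lemma transp_permutes: "i < n \<Longrightarrow> j < n \<Longrightarrow> transp i j permutes {..<n}"
proof -
  assume "i < n" "j < n"
  moreover have "transp i j = Transposition.transpose i j"
    by (auto simp: transp_def Transposition.transpose_def)
  ultimately show ?thesis by (simp add: permutes_swap_id)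
qed

lemma transp_invol [simp]: "transp i j (transp i j k) = k" "transp i j \<circ> (transp i j \<circ> f) = f"
  by (auto simp: transp_def fun_eq_iff)

text \<open>The transposition acts after \<open>p\<close>, so only points reached at positive times
  matter. The starting point may itself be \<open>i\<close> or \<open>j\<close>, which is how the
  orbits of these two layers are followed.\<close>

lemma transp_comp_funpow_eq:
  fixes p :: "nat \<Rightarrow> nat"
  assumes "\<And>m. 0 < m \<Longrightarrow> m \<le> k \<Longrightarrow> (p ^^ m) x \<noteq> i \<and> (p ^^ m) x \<noteq> j"
  shows "((transp i j \<circ> p) ^^ k) x = (p ^^ k) x"
  using assms
proof (induction k)
  case (Suc k)
  have "((transp i j \<circ> p) ^^ k) x = (p ^^ k) x"
    by (rule Suc.IH) (use Suc.prems in auto)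
  then have "((transp i j \<circ> p) ^^ Suc k) x = transp i j ((p ^^ Suc k) x)"
    by (simp only: funpow.simps comp_apply)
  also have "\<dots> = (p ^^ Suc k) x" using Suc.prems[of "Suc k"] unfolding transp_def by simp
  finally show ?case .
qed simp

context
  fixes p :: "nat \<Rightarrow> nat" and n i j :: nat
  assumes p: "p permutes {..<n}" and ij: "i < n" "j < n" "i \<noteq> j"
begin

lemma transp_comp_permutes: "(transp i j \<circ> p) permutes {..<n}"
  using permutes_compose[OF p transp_permutes] ij by simp

text \<open>The path from \<open>x\<close> follows the \<open>p\<close>-cycle of \<open>x\<close>
  until that cycle is about to close; at this moment the transposition diverts it to
  \<open>y\<close>. The formulation with \<open>x\<close> and \<open>y\<close> in
  \<open>{i, j}\<close> serves both cycles at once.\<close>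

lemma transp_merge_half:
  assumes "x \<in> {i, j}" "y \<in> {i, j}" "y \<notin> orbit_of p x"
  shows "orbit_of p x \<subseteq> orbit_of (transp i j \<circ> p) x" "y \<in> orbit_of (transp i j \<circ> p) x"
proof -
  let ?q = "transp i j \<circ> p"
  have xy: "x \<noteq> y" using assms(3) by auto
  then have xyij: "{x, y} = {i, j}" using assms by auto
  define l where "l = (LEAST l. 0 < l \<and> (p ^^ l) x = x)"
  have l: "0 < l" "(p ^^ l) x = x"
    using LeastI_ex[of "\<lambda>l. 0 < l \<and> (p ^^ l) x = x"] permutes_funpow_period[OF p, of x]
    unfolding l_def by metis+
  have lmin: "(p ^^ k) x \<noteq> x" if "0 < k" "k < l" for k
    using not_less_Least[of k "\<lambda>l. 0 < l \<and> (p ^^ l) x = x"] that unfolding l_def by auto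
  have noty: "(p ^^ k) x \<noteq> y" for k using assms(3) by (auto simp: orbit_of_def)
  have q: "(?q ^^ k) x = (p ^^ k) x" if "k < l" for k
  proof (rule transp_comp_funpow_eq)
    fix m assume "0 < m" "m \<le> k"
    then show "(p ^^ m) x \<noteq> i \<and> (p ^^ m) x \<noteq> j"
      using lmin[of m] noty[of m] that xyij by (auto simp: doubleton_eq_iff)
  qed
  have "(?q ^^ l) x = ?q ((?q ^^ (l - 1)) x)"
    using l(1) by (metis Suc_pred' funpow.simps(2) comp_apply)
  also have "\<dots> = transp i j ((p ^^ l) x)"
    using q[of "l - 1"] l(1) by (metis Suc_pred' funpow.simps(2) comp_apply diff_less zero_less_one)
  also have "\<dots> = y" using l(2) xyij xy by (auto simp: transp_def doubleton_eq_iff)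
  finally show "y \<in> orbit_of ?q x" by (auto simp: orbit_of_def)
  show "orbit_of p x \<subseteq> orbit_of ?q x"
  proof
    fix z assume "z \<in> orbit_of p x"
    then obtain k where "z = (p ^^ k) x" by (auto simp: orbit_of_def)
    moreover have "(p ^^ k) x = (p ^^ (k mod l)) x" using funpow_mod_eq[OF l(2)] by simp
    ultimately have "z = (?q ^^ (k mod l)) x" using q l(1) by simp
    then show "z \<in> orbit_of ?q x" by (auto simp: orbit_of_def)
  qed
qed

lemma transp_merge:
  assumes "j \<notin> orbit_of p i"
  shows "orbit_of (transp i j \<circ> p) i = orbit_of p i \<union> orbit_of p j"
proof
  have sym: "i \<notin> orbit_of p j" using assms orbit_of_sym[OF p] by blast
  have "orbit_of p j \<subseteq> orbit_of (transp i j \<circ> p) j" "j \<in> orbit_of (transp i j \<circ> p) i"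
    using transp_merge_half[of j i] transp_merge_half[of i j] assms sym by auto
  then have "orbit_of p j \<subseteq> orbit_of (transp i j \<circ> p) i"
    using orbit_of_trans by blast
  then show "orbit_of p i \<union> orbit_of p j \<subseteq> orbit_of (transp i j \<circ> p) i"
    using transp_merge_half[of i j] assms by auto
  show "orbit_of (transp i j \<circ> p) i \<subseteq> orbit_of p i \<union> orbit_of p j"
    by (rule orbit_of_subset) (auto simp: transp_def orbit_of_step)
qed

lemma transp_orbit_other:
  assumes "i \<notin> orbit_of p x" "j \<notin> orbit_of p x"
  shows "orbit_of (transp i j \<circ> p) x = orbit_of p x"
proof -
  have "((transp i j \<circ> p) ^^ k) x = (p ^^ k) x" for k
    by (rule transp_comp_funpow_eq) (use assms orbit_of_funpow in metis)
  then show ?thesis by (simp add: orbit_of_def)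
qed

text \<open>Let \<open>m\<close> be the first time at which the \<open>p\<close>-path of
  \<open>i\<close> reaches \<open>j\<close>. The transposition turns this visit into a return to
  \<open>i\<close>, so the new cycle of \<open>i\<close> consists of the points before
  \<open>j\<close>.\<close>

lemma transp_split:
  assumes "j \<in> orbit_of p i"
  shows "j \<notin> orbit_of (transp i j \<circ> p) i"
proof -
  let ?q = "transp i j \<circ> p"
  define m where "m = (LEAST m. (p ^^ m) i = j)"
  have m: "(p ^^ m) i = j"
    unfolding m_def by (rule LeastI_ex) (use assms in \<open>auto simp: orbit_of_def\<close>)
  have mmin: "(p ^^ k) i \<noteq> j" if "k < m" for k
    using not_less_Least that unfolding m_def by blast
  have "m > 0" using m ij by (cases m) auto
  \<comment> \<open>A return to \<open>i\<close> at a time \<open>k < m\<close> would make the path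
    reach \<open>j\<close> already at time \<open>m mod k\<close>, against the minimality of
    \<open>m\<close>.\<close>
  have noti: "(p ^^ k) i \<noteq> i" if "0 < k" "k < m" for k
  proof
    assume "(p ^^ k) i = i"
    then have "(p ^^ (m mod k)) i = j" using funpow_mod_eq m by metis
    then show False using mmin[of "m mod k"] that by (meson less_trans mod_less_divisor)
  qed
  have q: "(?q ^^ k) i = (p ^^ k) i" if "k < m" for k
    by (rule transp_comp_funpow_eq) (use noti mmin that in auto)
  have "(?q ^^ m) i = ?q ((?q ^^ (m - 1)) i)"
    using \<open>m > 0\<close> by (metis Suc_pred' funpow.simps(2) comp_apply)
  also have "\<dots> = transp i j ((p ^^ m) i)"
    using q[of "m - 1"] \<open>m > 0\<close>
    by (metis Suc_pred' funpow.simps(2) comp_apply diff_less zero_less_one)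
  finally have per: "(?q ^^ m) i = i" using m by (simp add: transp_def)
  show ?thesis
  proof
    assume "j \<in> orbit_of ?q i"
    then obtain k where "j = (?q ^^ k) i" by (auto simp: orbit_of_def)
    then have "(?q ^^ (k mod m)) i = j" using funpow_mod_eq[OF per] by metis
    then show False using q[of "k mod m"] mmin[of "k mod m"] \<open>m > 0\<close> by simp
  qed
qed

lemma transp_merge_orbits:
  assumes "j \<notin> orbit_of p i"
  shows "orbits n (transp i j \<circ> p) =
    insert (orbit_of p i \<union> orbit_of p j) (orbits n p - {orbit_of p i, orbit_of p j})"
proof (rule orbits_partition[OF transp_comp_permutes])
  fix x assume "x < n"
  then have x: "orbit_of p x \<in> orbits n p" "x \<in> orbit_of p x"
    using orbit_in_orbits[OF p] by auto
  show "\<exists>Q\<in>insert (orbit_of p i \<union> orbit_of p j)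
      (orbits n p - {orbit_of p i, orbit_of p j}). x \<in> Q"
  proof (cases "orbit_of p x = orbit_of p i \<or> orbit_of p x = orbit_of p j")
    case True
    then have "x \<in> orbit_of p i \<union> orbit_of p j" using x(2) by blast
    then show ?thesis by (rule bexI) (rule insertI1)
  next
    case False
    then have "orbit_of p x \<in> orbits n p - {orbit_of p i, orbit_of p j}" using x(1) by blast
    then show ?thesis using x(2) by (intro bexI[OF _ insertI2])
  qed
next
  fix Q assume "Q \<in> insert (orbit_of p i \<union> orbit_of p j)
      (orbits n p - {orbit_of p i, orbit_of p j})"
  then consider "Q = orbit_of p i \<union> orbit_of p j" | "Q \<in> orbits n p" "Q \<noteq> orbit_of p i" "Q \<noteq> orbit_of p j"
    by auto
  then show "\<exists>x<n. Q = orbit_of (transp i j \<circ> p) x"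
  proof cases
    case 1
    then show ?thesis using transp_merge[OF assms] ij(1) by (intro exI[of _ i]) simp
  next
    case 2
    then obtain x where x: "x < n" "Q = orbit_of p x" "Q \<noteq> orbit_of p i" "Q \<noteq> orbit_of p j"
      by (auto simp: orbits_def)
    then have "i \<notin> orbit_of p x" "j \<notin> orbit_of p x"
      using orbit_of_eq[OF p, of i x] orbit_of_eq[OF p, of j x] by auto
    then have "orbit_of (transp i j \<circ> p) x = orbit_of p x"
      by (rule transp_orbit_other)
    then show ?thesis using x by (intro exI[of _ x]) simp
  qed
qed

end

text \<open>The least layer serves as representative of its orbit; for \<open>f\<close> constant on
  orbits any other choice gives the same value. With \<open>f = scale s\<close> this is the weight
  of \<sigma> in the overview.\<close>

definition orbit_weight :: "nat \<Rightarrow> (nat \<Rightarrow> nat) \<Rightarrow> (nat \<Rightarrow> 'b) \<Rightarrow> 'b::comm_monoid_mult" where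
  "orbit_weight n p f = (\<Prod>Q\<in>orbits n p. f (Min Q))"

text \<open>Two orbits contribute \<open>f i\<close> each, their union contributes it once, and all
  other orbits are untouched. The facts \<open>fA\<close>, \<open>fB\<close>, \<open>fU\<close> are
  there because the least elements of these sets need not be \<open>i\<close> or
  \<open>j\<close>.\<close>

lemma orbit_weight_merge:
  assumes p: "p permutes {..<n}" and ij: "i < n" "j < n" "i \<noteq> j"
    and f: "\<And>x. f (p x) = f x" "f i = f j" and nj: "j \<notin> orbit_of p i"
  shows "orbit_weight n p f = f i * orbit_weight n (transp i j \<circ> p) f"
proof -
  let ?A = "orbit_of p i" and ?B = "orbit_of p j" and ?q = "transp i j \<circ> p"
  let ?R = "orbits n p - {?A, ?B}"
  have A: "?A \<in> orbits n p" and B: "?B \<in> orbits n p" using orbit_in_orbits[OF p] ij by auto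
  have AB: "?A \<noteq> ?B" using nj orbit_of_self by metis
  have U: "?A \<union> ?B \<in> orbits n ?q" unfolding transp_merge_orbits[OF p ij nj] by simp
  have fq: "f (?q x) = f x" for x
    using f(1)[of x] f(2) unfolding transp_def comp_apply by (metis (full_types))
  have fA: "f (Min ?A) = f i"
    by (rule invariant_on_orbit[where p = p and s = f]) (use f orbit_Min_in[OF p A] in auto)
  have fB: "f (Min ?B) = f i"
    using invariant_on_orbit[where s = f and p = p] f orbit_Min_in[OF p B] by metis
  have fU: "f (Min (?A \<union> ?B)) = f i"
    by (rule invariant_on_orbit[where p = ?q and s = f, OF fq])
       (use orbit_Min_in[OF transp_comp_permutes[OF p ij] U] transp_merge[OF p ij nj] in simp)
  have "?A \<union> ?B \<notin> ?R"
  proof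
    assume "?A \<union> ?B \<in> ?R"
    then have "?A \<union> ?B = ?A" using orbit_eq_orbit_of[OF p, of "?A \<union> ?B" i] by simp
    then show False using nj orbit_of_self[of j p] by blast
  qed
  then have "orbit_weight n ?q f = f i * (\<Prod>Q\<in>?R. f (Min Q))"
    unfolding orbit_weight_def transp_merge_orbits[OF p ij nj] using finite_orbits[OF p] fU by simp
  moreover have "orbit_weight n p f = f i * (f i * (\<Prod>Q\<in>?R. f (Min Q)))"
  proof -
    have "orbits n p = insert ?A (insert ?B ?R)" using A B by auto
    then have "orbit_weight n p f = (\<Prod>Q\<in>insert ?A (insert ?B ?R). f (Min Q))"
      by (simp only: orbit_weight_def)
    also have "\<dots> = f i * (f i * (\<Prod>Q\<in>?R. f (Min Q)))"
      using AB fA fB finite_orbits[OF p] by (simp add: prod.insert)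
    finally show ?thesis .
  qed
  ultimately show ?thesis by simp
qed

text \<open>The transposition is an involution, and it separates \<open>i\<close> from
  \<open>j\<close>; so this is the merging case for \<open>transp i j \<circ> p\<close>, read
  backwards.\<close>

lemma orbit_weight_split:
  assumes p: "p permutes {..<n}" and ij: "i < n" "j < n" "i \<noteq> j"
    and f: "\<And>x. f (p x) = f x" "f i = f j" and j: "j \<in> orbit_of p i"
  shows "orbit_weight n (transp i j \<circ> p) f = f i * orbit_weight n p f"
proof -
  have "f ((transp i j \<circ> p) x) = f x" for x
    using f(1)[of x] f(2) unfolding transp_def comp_apply by (metis (full_types))
  then have "orbit_weight n (transp i j \<circ> p) f =
      f i * orbit_weight n (transp i j \<circ> (transp i j \<circ> p)) f"
    by (intro orbit_weight_merge)
       (use f ij transp_comp_permutes[OF p ij] transp_split[OF p ij j] in auto)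
  then show ?thesis by simp
qed

section \<open>Decomposition into transpositions\<close>

text \<open>The cardinality that governs the length of \<open>cycle_transps\<close> is the least
  positive return time \<open>l'\<close> of \<open>m\<close>: up to it the iterates are distinct,
  and afterwards they repeat.\<close>

lemma orbit_period:
  fixes n m :: nat and r :: "nat \<Rightarrow> nat"
  assumes r: "r permutes {..<n}"
  defines "l \<equiv> card (orbit_of r m)"
  shows "inj_on (\<lambda>k. (r ^^ k) m) {..<l}" "(r ^^ l) m = m"
    "orbit_of r m = (\<lambda>k. (r ^^ k) m) ` {..<l}" "0 < l"
proof -
  define l' where "l' = (LEAST l. 0 < l \<and> (r ^^ l) m = m)"
  have l': "0 < l'" "(r ^^ l') m = m"
    using LeastI_ex[of "\<lambda>l. 0 < l \<and> (r ^^ l) m = m"] permutes_funpow_period[OF r, of m]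
    unfolding l'_def by metis+
  have lmin: "(r ^^ k) m \<noteq> m" if "0 < k" "k < l'" for k
    using not_less_Least[of k "\<lambda>l. 0 < l \<and> (r ^^ l) m = m"] that unfolding l'_def by auto
  have ne: "(r ^^ a) m \<noteq> (r ^^ b) m" if "a < b" "b < l'" for a b
  proof
    assume "(r ^^ a) m = (r ^^ b) m"
    then have "(r ^^ (b - a)) m = m"
      using funpow_diff[OF permutes_inj[OF r], of a b m] that by simp
    then show False using lmin[of "b - a"] that by simp
  qed
  have inj: "inj_on (\<lambda>k. (r ^^ k) m) {..<l'}"
    by (rule inj_onI) (metis lessThan_iff ne linorder_neqE_nat)
  have "(r ^^ k) m \<in> (\<lambda>k. (r ^^ k) m) ` {..<l'}" for k
    using funpow_mod_eq[OF l'(2), of k] l'(1)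
    by (metis imageI lessThan_iff mod_less_divisor)
  then have orb: "orbit_of r m = (\<lambda>k. (r ^^ k) m) ` {..<l'}"
    by (auto simp: orbit_of_def)
  then have "l = l'" using card_image[OF inj] by (simp add: l_def)
  then show "inj_on (\<lambda>k. (r ^^ k) m) {..<l}" "(r ^^ l) m = m"
    "orbit_of r m = (\<lambda>k. (r ^^ k) m) ` {..<l}" "0 < l" using inj orb l' by auto
qed

lemma pi_after_append: "pi_after (xs @ ys) s = pi_after xs (pi_after ys s)"
  by (simp add: pi_after_def)

lemma pi_after_simps [simp]:
  "pi_after [] s = s" "pi_after (t # ts) s = transp (fst t) (snd t) \<circ> pi_after ts s"
  by (simp_all add: pi_after_def)

lemma pi_after_comp: "pi_after ts s = pi_after ts id \<circ> s"
  by (induction ts) (simp_all add: comp_assoc)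

lemma pi_after_permutes:
  assumes "\<And>t. t \<in> set ts \<Longrightarrow> fst t < n \<and> snd t < n" "s permutes {..<n}"
  shows "pi_after ts s permutes {..<n}"
  using assms(1)
proof (induction ts)
  case (Cons t ts)
  then have "pi_after ts s permutes {..<n}" "transp (fst t) (snd t) permutes {..<n}"
    using transp_permutes[of "fst t" n "snd t"] by auto
  then show ?case unfolding pi_after_simps by (intro permutes_compose)
qed (use assms in simp)

text \<open>The first \<open>L\<close> transpositions multiply to the cycle on the
  \<open>L + 1\<close> points from \<open>m\<close> to \<open>(r ^^ L) m\<close>, which agrees with
  \<open>r\<close> except that it closes up at the last point. This intermediate form carries the
  induction on \<open>L\<close>.\<close>

lemma pi_after_cycle_prefix:
  fixes n :: nat
  assumes r: "r permutes {..<n}" and L: "L < card (orbit_of r m)"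
  shows "pi_after (map (\<lambda>k. ((r ^^ k) m, (r ^^ Suc k) m)) [0..<L]) id x =
    (if \<exists>k<L. x = (r ^^ k) m then r x else if x = (r ^^ L) m then m else x)"
  using L
proof (induction L arbitrary: x)
  case (Suc L)
  have ne: "(r ^^ a) m \<noteq> (r ^^ b) m" if "a < b" "b < card (orbit_of r m)" for a b
    using inj_onD[OF orbit_period(1)[OF r, of m], of a b] that by auto
  define P where "P = pi_after (map (\<lambda>k. ((r ^^ k) m, (r ^^ Suc k) m)) [0..<L]) id"
  have IH: "P y = (if \<exists>k<L. y = (r ^^ k) m then r y else if y = (r ^^ L) m then m else y)" for y
    unfolding P_def using Suc.IH Suc.prems by (meson Suc_lessD)
  \<comment> \<open>The last transposition of the list is the rightmost factor, so it acts on
    \<open>x\<close> before the shorter product \<open>P\<close> does.\<close>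
  have "pi_after (map (\<lambda>k. ((r ^^ k) m, (r ^^ Suc k) m)) [0..<Suc L]) id x =
      P (transp ((r ^^ L) m) ((r ^^ Suc L) m) x)"
    using pi_after_comp[of "map (\<lambda>k. ((r ^^ k) m, (r ^^ Suc k) m)) [0..<L]"
        "transp ((r ^^ L) m) ((r ^^ Suc L) m)"]
    by (simp add: pi_after_append P_def)
  also have "\<dots> = (if \<exists>k<Suc L. x = (r ^^ k) m then r x
      else if x = (r ^^ Suc L) m then m else x)"
  proof -
    consider (a) "x = (r ^^ L) m" | (b) "x = (r ^^ Suc L) m" | (c) "x \<noteq> (r ^^ L) m" "x \<noteq> (r ^^ Suc L) m"
      by blast
    then show ?thesis
    proof cases
      case a
      have "(r ^^ Suc L) m \<noteq> (r ^^ k) m" if "k \<le> L" for k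
        using ne[of k "Suc L"] that Suc.prems by (metis le_imp_less_Suc)
      then have "P ((r ^^ Suc L) m) = (r ^^ Suc L) m"
        unfolding IH by (metis less_imp_le order_refl)
      moreover have "transp ((r ^^ L) m) ((r ^^ Suc L) m) x = (r ^^ Suc L) m"
        using a by (simp add: transp_def)
      moreover have "\<exists>k<Suc L. x = (r ^^ k) m" "r x = (r ^^ Suc L) m" using a by auto
      ultimately show ?thesis by simp
    next
      case b
      have "(r ^^ Suc L) m \<noteq> (r ^^ k) m" if "k \<le> L" for k
        using ne[of k "Suc L"] that Suc.prems by (metis le_imp_less_Suc)
      moreover have "(r ^^ L) m \<noteq> (r ^^ k) m" if "k < L" for k
        using ne[of k L] that Suc.prems by (metis Suc_lessD)
      ultimately show ?thesis using b IH[of "(r ^^ L) m"] unfolding transp_def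
        by (auto simp: less_Suc_eq_le)
    next
      case c
      then show ?thesis using IH[of x] unfolding transp_def by (auto simp: less_Suc_eq)
    qed
  qed
  finally show ?case .
qed simp

lemma pi_after_cycle_transps:
  fixes n :: nat
  assumes r: "r permutes {..<n}"
  shows "pi_after (cycle_transps r m) id x = (if x \<in> orbit_of r m then r x else x)"
proof -
  define l where "l = card (orbit_of r m)"
  note per = orbit_period[OF r, of m, folded l_def]
  obtain L where L: "l = Suc L" using per(4) by (cases l) auto
  \<comment> \<open>At the last point of the full cycle, closing up at \<open>m\<close> is what
    \<open>r\<close> does as well.\<close>
  have "r ((r ^^ L) m) = m" using per(2) unfolding L by simp
  moreover have "x \<in> orbit_of r m \<longleftrightarrow> (\<exists>k<L. x = (r ^^ k) m) \<or> x = (r ^^ L) m"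
    unfolding per(3) L by (auto simp: less_Suc_eq)
  ultimately show ?thesis
    using pi_after_cycle_prefix[OF r, of L m x] L
    unfolding cycle_transps_def l_def by (auto simp del: upt_Suc)
qed

definition orbit_mins :: "nat \<Rightarrow> (nat \<Rightarrow> nat) \<Rightarrow> nat set" where
  "orbit_mins n r = {m. m < n \<and> m = Min (orbit_of r m)}"

context
  fixes r :: "nat \<Rightarrow> nat" and n :: nat
  assumes r: "r permutes {..<n}"
begin

lemma finite_orbit_mins [simp]: "finite (orbit_mins n r)"
  by (simp add: orbit_mins_def)

lemma Min_orbit_mins: "Q \<in> orbits n r \<Longrightarrow> Min Q \<in> orbit_mins n r"
  using orbit_Min_in[OF r] orbit_less[OF r] orbit_eq_orbit_of[OF r]
  unfolding orbit_mins_def by (metis (mono_tags, lifting) mem_Collect_eq)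

lemma bij_betw_orbit_mins: "bij_betw (orbit_of r) (orbit_mins n r) (orbits n r)"
proof (rule bij_betwI[where g = Min])
  show "orbit_of r \<in> orbit_mins n r \<rightarrow> orbits n r"
    using orbit_in_orbits[OF r] by (auto simp: orbit_mins_def)
  show "Min \<in> orbits n r \<rightarrow> orbit_mins n r" using Min_orbit_mins by blast
  show "Min (orbit_of r x) = x" if "x \<in> orbit_mins n r" for x using that by (simp add: orbit_mins_def)
  show "orbit_of r (Min Q) = Q" if "Q \<in> orbits n r" for Q
    using orbit_eq_orbit_of[OF r that orbit_Min_in[OF r that]] by simp
qed

text \<open>A point moved by the cycles in \<open>ms\<close> stays in its own orbit, which is
  disjoint from the orbit of \<open>m\<close>; hence no point is moved twice.\<close>

lemma pi_after_cycles:
  assumes "distinct ms" "set ms \<subseteq> orbit_mins n r"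
  shows "pi_after (concat (map (cycle_transps r) ms)) id x =
    (if \<exists>m\<in>set ms. x \<in> orbit_of r m then r x else x)"
  using assms
proof (induction ms)
  case (Cons m ms)
  define R where "R = pi_after (concat (map (cycle_transps r) ms)) id"
  have IH: "R x = (if \<exists>m\<in>set ms. x \<in> orbit_of r m then r x else x)"
    unfolding R_def by (rule Cons.IH) (use Cons.prems in auto)
  have step: "pi_after (concat (map (cycle_transps r) (m # ms))) id x =
      (if R x \<in> orbit_of r m then r (R x) else R x)"
    using pi_after_comp[of "cycle_transps r m" R]
    by (simp add: pi_after_append pi_after_cycle_transps[OF r] R_def[symmetric])
  show ?case
  proof (cases "\<exists>m'\<in>set ms. x \<in> orbit_of r m'")
    case True
    then obtain m' where m': "m' \<in> set ms" "x \<in> orbit_of r m'" by blast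
    then have "r x \<in> orbit_of r m'" by (rule_tac orbit_of_step)
    moreover have "orbit_of r m \<noteq> orbit_of r m'"
      using Cons.prems m' bij_betw_orbit_mins by (auto simp: bij_betw_def inj_on_def)
    ultimately have "r x \<notin> orbit_of r m" using orbit_of_eq[OF r] by metis
    moreover have "R x = r x" using IH True by auto
    ultimately show ?thesis unfolding step using True by auto
  next
    case False
    then have "R x = x" using IH by auto
    then show ?thesis unfolding step using False by auto
  qed
qed simp

lemma pi_after_transp_decomp: "pi_after (transp_decomp n r) s = r \<circ> s"
proof -
  have "pi_after (transp_decomp n r) id x = r x" for x
  proof (cases "x < n")
    case True
    then have "Min (orbit_of r x) \<in> orbit_mins n r" "Min (orbit_of r x) \<in> orbit_of r x"
      using Min_orbit_mins orbit_Min_in[OF r] orbit_in_orbits[OF r] by auto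
    then have "\<exists>m\<in>orbit_mins n r. x \<in> orbit_of r m" using orbit_of_sym[OF r] by blast
    then show ?thesis
      unfolding transp_decomp_def orbit_mins_def[symmetric]
      by (subst pi_after_cycles) auto
  next
    case False
    then have "r x = x" using r by (simp add: permutes_not_in)
    then show ?thesis
      unfolding transp_decomp_def orbit_mins_def[symmetric]
      by (subst pi_after_cycles) auto
  qed
  then show ?thesis using pi_after_comp[of _ s] by (metis ext)
qed

lemma set_transp_decomp:
  "set (transp_decomp n r) = {((r ^^ k) m, (r ^^ Suc k) m) | k m.
     m \<in> orbit_mins n r \<and> Suc k < card (orbit_of r m)}"
  unfolding transp_decomp_def orbit_mins_def[symmetric] cycle_transps_def
  by (auto simp: less_diff_conv) blast

lemma transp_decomp_bounds:
  assumes "t \<in> set (transp_decomp n r)"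
  shows "fst t < n" "snd t < n" "fst t \<noteq> snd t"
proof -
  obtain k m where m: "m \<in> orbit_mins n r" "Suc k < card (orbit_of r m)"
    and t: "t = ((r ^^ k) m, (r ^^ Suc k) m)"
    using assms unfolding set_transp_decomp by blast
  have "(r ^^ j) m < n" for j
    using orbit_of_bounded[OF r] orbit_of_funpow[of j r m] m by (auto simp: orbit_mins_def)
  then show "fst t < n" "snd t < n" by (metis t fst_conv snd_conv)+
  show "fst t \<noteq> snd t"
    using inj_onD[OF orbit_period(1)[OF r, of m], of k "Suc k"] m by (auto simp: t)
qed

text \<open>The listed pairs are consecutive points of the cycles of \<open>r\<close>, and
  conversely \<open>r\<close> is the product of the listed transpositions. This converts the
  condition on single factors in \<open>F\<close> into invariance of the labeling.\<close>

lemma invariant_transp_decomp: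
  "(\<forall>t\<in>set (transp_decomp n r). f (fst t) = f (snd t)) \<longleftrightarrow> (\<forall>x. f (r x) = f x)"
proof
  assume inv: "\<forall>x. f (r x) = f x"
  show "\<forall>t\<in>set (transp_decomp n r). f (fst t) = f (snd t)"
    unfolding set_transp_decomp using inv by auto
next
  assume inv: "\<forall>t\<in>set (transp_decomp n r). f (fst t) = f (snd t)"
  have "f (pi_after ts id x) = f x" if "\<forall>t\<in>set ts. f (fst t) = f (snd t)" for ts x
    using that
  proof (induction ts)
    case (Cons t ts)
    have "f (transp (fst t) (snd t) y) = f y" for y
      using Cons.prems by (auto simp: transp_def)
    moreover have "f (pi_after ts id x) = f x"
      by (rule Cons.IH) (use Cons.prems in auto)
    ultimately show ?case by (simp only: pi_after_simps comp_apply)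
  qed simp
  from this[OF inv] show "\<forall>x. f (r x) = f x" by (simp add: pi_after_transp_decomp)
qed

text \<open>A cycle of length \<open>l\<close> is written with \<open>l - 1\<close> transpositions
  and so gives \<open>l - 1\<close> equal factors; the orbit weight supplies the missing
  one.\<close>

lemma prod_transp_decomp:
  fixes f :: "nat \<Rightarrow> 'b::comm_monoid_mult"
  assumes inv: "\<And>x. f (r x) = f x"
  shows "(\<Prod>t\<leftarrow>transp_decomp n r. f (fst t)) * orbit_weight n r f = prod f {..<n}"
proof -
  let ?M = "orbit_mins n r" and ?c = "\<lambda>m. card (orbit_of r m)"
  have fk: "f ((r ^^ k) m) = f m" for k m by (induction k) (auto simp: inv)
  have cyc: "(\<Prod>t\<leftarrow>cycle_transps r m. f (fst t)) = f m ^ (?c m - 1)" for m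
    by (simp add: cycle_transps_def comp_def fk map_replicate_const del: upt_Suc)
  have "(\<Prod>t\<leftarrow>transp_decomp n r. f (fst t)) =
      (\<Prod>m\<leftarrow>sorted_list_of_set ?M. f m ^ (?c m - 1))"
  proof -
    have "(\<Prod>t\<leftarrow>concat (map (cycle_transps r) ms). f (fst t)) = (\<Prod>m\<leftarrow>ms. f m ^ (?c m - 1))" for ms
      by (induction ms) (simp_all add: cyc)
    then show ?thesis unfolding transp_decomp_def orbit_mins_def .
  qed
  also have "\<dots> = (\<Prod>m\<in>?M. f m ^ (?c m - 1))"
    by (simp add: prod.distinct_set_conv_list[symmetric])
  finally have 1: "(\<Prod>t\<leftarrow>transp_decomp n r. f (fst t)) = (\<Prod>m\<in>?M. f m ^ (?c m - 1))" .
  have 2: "orbit_weight n r f = (\<Prod>m\<in>?M. f m)"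
    unfolding orbit_weight_def prod.reindex_bij_betw[OF bij_betw_orbit_mins, symmetric]
    by (rule prod.cong) (auto simp: orbit_mins_def)
  have c: "?c m > 0" for m using orbit_period(4)[OF r] .
  have "prod f {..<n} = (\<Prod>m\<in>?M. prod f (orbit_of r m))"
    unfolding prod_over_orbits[OF r] by (simp add: prod.reindex_bij_betw[OF bij_betw_orbit_mins])
  also have "\<dots> = (\<Prod>m\<in>?M. f m ^ ?c m)"
  proof (rule prod.cong[OF refl])
    fix m
    have "prod f (orbit_of r m) = (\<Prod>_\<in>orbit_of r m. f m)"
      by (rule prod.cong) (auto simp: orbit_of_def fk)
    then show "prod f (orbit_of r m) = f m ^ ?c m" by simp
  qed
  also have "\<dots> = (\<Prod>m\<in>?M. f m ^ (?c m - 1) * f m)"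
    by (rule prod.cong[OF refl], rule power_minus_mult[symmetric, OF c])
  finally show ?thesis by (simp add: 1 2 prod.distrib)
qed

end

section \<open>Characters of the fusion ring\<close>

text \<open>Elimination: a pivot \<open>j0\<close> with nonzero coordinate \<open>i\<close> clears
  this coordinate from the other vectors, and the induction hypothesis applies to what
  remains.\<close>

lemma linear_dependence:
  fixes v :: "'j \<Rightarrow> 'i \<Rightarrow> 'k::field"
  assumes "finite I" "finite J" "card I < card J"
  shows "\<exists>c. (\<exists>j\<in>J. c j \<noteq> 0) \<and> (\<forall>i\<in>I. (\<Sum>j\<in>J. c j * v j i) = 0)"
  using assms
proof (induction I arbitrary: J v rule: finite_induct)
  case empty
  then have "J \<noteq> {}" by auto
  then show ?case by (intro exI[of _ "\<lambda>_. 1"]) auto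
next
  case (insert i I)
  show ?case
  proof (cases "\<forall>j\<in>J. v j i = 0")
    case True
    obtain c where "\<exists>j\<in>J. c j \<noteq> 0" "\<forall>i\<in>I. (\<Sum>j\<in>J. c j * v j i) = 0"
      using insert.IH[of J v] insert.prems insert.hyps by auto
    then show ?thesis using True by (intro exI[of _ c]) auto
  next
    case False
    then obtain j0 where j0: "j0 \<in> J" "v j0 i \<noteq> 0" by blast
    let ?J = "J - {j0}"
    have "card I < card ?J" using insert.prems insert.hyps j0 by simp
    then obtain c where c: "\<exists>j\<in>?J. c j \<noteq> 0"
      "\<And>x. x \<in> I \<Longrightarrow> (\<Sum>j\<in>?J. c j * (v j x - v j i / v j0 i * v j0 x)) = 0"
      using insert.IH[of ?J "\<lambda>j x. v j x - v j i / v j0 i * v j0 x"] insert.prems by auto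
    \<comment> \<open>The coefficient of the pivot collects the multiples of \<open>v j0\<close>
      that were subtracted from the other vectors.\<close>
    define c' where "c' = c(j0 := - (\<Sum>j\<in>?J. c j * v j i / v j0 i))"
    have eq: "(\<Sum>j\<in>J. c' j * v j x) = (\<Sum>j\<in>?J. c j * (v j x - v j i / v j0 i * v j0 x))" for x
    proof -
      have "(\<Sum>j\<in>J. c' j * v j x) = c' j0 * v j0 x + (\<Sum>j\<in>?J. c' j * v j x)"
        using j0 insert.prems by (simp add: sum.remove)
      also have "(\<Sum>j\<in>?J. c' j * v j x) = (\<Sum>j\<in>?J. c j * v j x)"
        by (rule sum.cong) (auto simp: c'_def)
      finally show ?thesis
        by (simp add: c'_def right_diff_distrib sum_subtractf sum_distrib_right mult.assoc)
    qed
    have "(\<Sum>j\<in>J. c' j * v j x) = 0" if "x \<in> insert i I" for x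
    proof (cases "x = i")
      case True
      then show ?thesis unfolding eq using j0 by simp
    next
      case False
      then show ?thesis unfolding eq using c(2) that by blast
    qed
    moreover have "\<exists>j\<in>J. c' j \<noteq> 0" using c(1) by (auto simp: c'_def)
    ultimately show ?thesis by blast
  qed
qed

text \<open>The vectors obtained from \<open>v\<close> by at most \<open>card I\<close> applications
  of \<open>T\<close> are dependent, so some nonzero polynomial in \<open>T\<close> kills
  \<open>v\<close>. Splitting off a root \<open>z\<close>, either the cofactor \<open>q\<close>
  already kills \<open>v\<close>, or its value on \<open>v\<close> is an eigenvector for
  \<open>z\<close>. The space \<open>V\<close> is given by closure properties only; the support in
  \<open>I\<close> bounds its dimension.\<close>

lemma invariant_subspace_eigenvector:
  fixes T :: "('a \<Rightarrow> complex) \<Rightarrow> ('a \<Rightarrow> complex)"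
  assumes fin: "finite I" and supp: "\<And>f x. f \<in> V \<Longrightarrow> x \<notin> I \<Longrightarrow> f x = 0"
    and lin: "\<And>f g c d. f \<in> V \<Longrightarrow> g \<in> V \<Longrightarrow> (\<lambda>x. c * f x + d * g x) \<in> V"
    and T: "\<And>f. f \<in> V \<Longrightarrow> T f \<in> V"
    and Tlin: "\<And>f g c d. f \<in> V \<Longrightarrow> g \<in> V \<Longrightarrow>
      T (\<lambda>x. c * f x + d * g x) = (\<lambda>x. c * T f x + d * T g x)"
    and v: "v \<in> V" "v \<noteq> (\<lambda>_. 0)"
  shows "\<exists>z f. f \<in> V \<and> f \<noteq> (\<lambda>_. 0) \<and> T f = (\<lambda>x. z * f x)"
proof -
  define N where "N = card I"
  define w where "w k = (T ^^ k) v" for k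
  have wV: "w k \<in> V" for k unfolding w_def by (induction k) (use v T in auto)
  have w_Suc: "w (Suc k) = T (w k)" for k by (simp add: w_def)
  have sums: "(\<lambda>x. \<Sum>k<m. c k * w k x) \<in> V \<and>
      T (\<lambda>x. \<Sum>k<m. c k * w k x) = (\<lambda>x. \<Sum>k<m. c k * w (Suc k) x)" for c m
  proof (induction m)
    case 0
    show ?case using lin[OF v(1) v(1), of 0 0] Tlin[OF v(1) v(1), of 0 0] by simp
  next
    case (Suc m)
    then show ?case
      using lin[of "\<lambda>x. \<Sum>k<m. c k * w k x" "w m" 1 "c m"]
        Tlin[of "\<lambda>x. \<Sum>k<m. c k * w k x" "w m" 1 "c m"] wV by (simp add: w_Suc)
  qed
  \<comment> \<open>For \<open>degree p \<le> N\<close> this is \<open>p(T)\<close> applied to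
    \<open>v\<close>; coefficients beyond \<open>N\<close> are cut off.\<close>
  define ev where "ev p = (\<lambda>x. \<Sum>k<Suc N. coeff p k * w k x)" for p :: "complex poly"
  have evV: "ev p \<in> V" for p unfolding ev_def using sums by blast
  have "\<exists>z f. f \<in> V \<and> f \<noteq> (\<lambda>_. 0) \<and> T f = (\<lambda>x. z * f x)"
    if "p \<noteq> 0" "degree p \<le> N" "ev p = (\<lambda>_. 0)" for p
    using that
  proof (induction "degree p" arbitrary: p)
    case 0
    then obtain c where c: "p = [:c:]" "c \<noteq> 0" by (metis pCons_0_0 degree_eq_zeroE)
    have "ev p = (\<lambda>x. c * v x)"
      unfolding ev_def c by (subst sum.lessThan_Suc_shift) (simp add: w_def coeff_pCons)
    then have "v = (\<lambda>_. 0)" using 0 c by (auto simp: fun_eq_iff)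
    then show ?case using v by simp
  next
    case (Suc d)
    then obtain z where "poly p z = 0"
      using fundamental_theorem_of_algebra[of p] constant_degree[of p] by auto
    then obtain q where q: "p = [:- z, 1:] * q" using poly_eq_0_iff_dvd by (metis dvdE)
    then have q0: "q \<noteq> 0" using Suc by auto
    then have dq: "degree q = d" using Suc q by (simp add: degree_mult_eq del: mult_pCons_left)
    \<comment> \<open>With zero top coefficient, applying \<open>T\<close> to \<open>ev q\<close>
      does not lead out of the truncated range, so multiplying \<open>q\<close> by the variable
      corresponds to \<open>T\<close>.\<close>
    have qN: "coeff q N = 0" using dq Suc by (intro coeff_eq_0) simp
    have "ev p = (\<lambda>x. T (ev q) x - z * ev q x)"
    proof
      fix x
      have "coeff p k = coeff (pCons 0 q) k - z * coeff q k" for k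
        unfolding q by simp
      then have "ev p x = (\<Sum>k<Suc N. coeff (pCons 0 q) k * w k x) - z * ev q x"
        unfolding ev_def by (simp only: left_diff_distrib sum_subtractf sum_distrib_left mult.assoc)
      also have "(\<Sum>k<Suc N. coeff (pCons 0 q) k * w k x) = (\<Sum>k<N. coeff q k * w (Suc k) x)"
        by (subst sum.lessThan_Suc_shift) simp
      also have "\<dots> = T (ev q) x"
        using conjunct2[OF sums[where c = "coeff q" and m = "Suc N"]] qN unfolding ev_def by (simp add: fun_eq_iff)
      finally show "ev p x = T (ev q) x - z * ev q x" .
    qed
    then have "T (ev q) = (\<lambda>x. z * ev q x)" using Suc.prems by (simp add: fun_eq_iff)
    then show ?case using Suc.hyps(1)[of q] dq q0 Suc evV[of q] by (metis Suc_leD)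
  qed
  moreover obtain c where c: "\<exists>k<Suc N. c k \<noteq> 0" "\<forall>x\<in>I. (\<Sum>k<Suc N. c k * w k x) = 0"
    using linear_dependence[OF fin, of "{..<Suc N}" w] by (auto simp: N_def)
  moreover define p where "p = (\<Sum>k<Suc N. monom (c k) k)"
  moreover have cp: "coeff p k = (if k < Suc N then c k else 0)" for k
    unfolding p_def coeff_sum by (simp add: coeff_monom)
  moreover have "p \<noteq> 0" using c(1) cp by (metis coeff_0)
  moreover have "degree p \<le> N" by (rule degree_le) (simp add: cp)
  moreover have "ev p x = 0" for x
  proof (cases "x \<in> I")
    case True
    then show ?thesis using c(2) unfolding ev_def by (simp add: cp)
  qed (use supp evV in blast)
  then have "ev p = (\<lambda>_. 0)" by blast
  ultimately show ?thesis by blast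
qed

text \<open>Unital ring homomorphisms from the fusion ring to the complex numbers, given on simple
  objects. The value 0 elsewhere makes characters with equal values on \<open>Irr C\<close> equal as
  functions.\<close>

definition characters :: "'a fusion_data \<Rightarrow> ('a \<Rightarrow> complex) set" where
  "characters C = {\<chi>. (\<forall>x. x \<notin> Irr C \<longrightarrow> \<chi> x = 0) \<and> \<chi> (unit C) = 1 \<and>
     (\<forall>a\<in>Irr C. \<forall>b\<in>Irr C. \<chi> a * \<chi> b = (\<Sum>c\<in>Irr C. of_nat (Nf C a b c) * \<chi> c))}"

text \<open>The number \<kappa> of the overview. For the character \<open>S_ab / S_1b\<close> of a
  unitary modular S-matrix it is the absolute value of \<open>S_1b\<close>.\<close>

definition char_scale :: "'a fusion_data \<Rightarrow> ('a \<Rightarrow> complex) \<Rightarrow> real" where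
  "char_scale C \<chi> = 1 / sqrt (\<Sum>a\<in>Irr C. (cmod (\<chi> a))\<^sup>2)"

locale fusion =
  fixes C :: "'a fusion_data"
  assumes rules: "mtc_fusion_rules C"
begin

lemma finite_Irr [simp]: "finite (Irr C)"
  and unit_Irr [simp]: "unit C \<in> Irr C"
  and dual_Irr [simp]: "a \<in> Irr C \<Longrightarrow> dual C a \<in> Irr C"
  and dual_dual [simp]: "a \<in> Irr C \<Longrightarrow> dual C (dual C a) = a"
  and N_unit_left: "a \<in> Irr C \<Longrightarrow> c \<in> Irr C \<Longrightarrow> Nf C (unit C) a c = (if a = c then 1 else 0)"
  and N_unit_right: "a \<in> Irr C \<Longrightarrow> c \<in> Irr C \<Longrightarrow> Nf C a (unit C) c = (if a = c then 1 else 0)"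
  and N_commute: "a \<in> Irr C \<Longrightarrow> b \<in> Irr C \<Longrightarrow> c \<in> Irr C \<Longrightarrow> Nf C a b c = Nf C b a c"
  and N_assoc: "a \<in> Irr C \<Longrightarrow> b \<in> Irr C \<Longrightarrow> c \<in> Irr C \<Longrightarrow> d \<in> Irr C \<Longrightarrow>
        (\<Sum>e\<in>Irr C. Nf C a b e * Nf C e c d) = (\<Sum>e\<in>Irr C. Nf C b c e * Nf C a e d)"
  and N_unit: "a \<in> Irr C \<Longrightarrow> b \<in> Irr C \<Longrightarrow> Nf C a b (unit C) = (if b = dual C a then 1 else 0)"
  and N_dual: "a \<in> Irr C \<Longrightarrow> b \<in> Irr C \<Longrightarrow> c \<in> Irr C \<Longrightarrow>
        Nf C a b c = Nf C (dual C b) (dual C a) (dual C c)"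
  using rules unfolding mtc_fusion_rules_def by blast+

lemma dual_unit [simp]: "dual C (unit C) = unit C"
  using N_unit[of "unit C" "unit C"] N_unit_left[of "unit C" "unit C"] unit_Irr
  by (metis zero_neq_one)

lemma dual_eq_iff: "a \<in> Irr C \<Longrightarrow> b \<in> Irr C \<Longrightarrow> a = dual C b \<longleftrightarrow> b = dual C a"
  by auto

text \<open>Both sides are the coefficient of the unit in the triple product of \<open>a\<close>,
  \<open>b\<close>, \<open>c\<close>, bracketed in the two possible ways.\<close>

lemma N_rotate:
  assumes "a \<in> Irr C" "b \<in> Irr C" "c \<in> Irr C"
  shows "Nf C a b (dual C c) = Nf C b c (dual C a)"
proof -
  have "(\<Sum>e\<in>Irr C. Nf C a b e * Nf C e c (unit C)) = (\<Sum>e\<in>Irr C. Nf C a b e * (if e = dual C c then 1 else 0))"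
    by (rule sum.cong) (use assms N_unit dual_eq_iff in auto)
  moreover have "(\<Sum>e\<in>Irr C. Nf C b c e * Nf C a e (unit C)) = (\<Sum>e\<in>Irr C. Nf C b c e * (if e = dual C a then 1 else 0))"
    by (rule sum.cong) (use assms N_unit in auto)
  ultimately show ?thesis using N_assoc[OF assms unit_Irr] assms
    by (simp add: if_distrib[of "(*) _"] cong: if_cong)
qed

text \<open>Two rotations followed by duality. In matrix form: fusion with \<open>dual C a\<close>
  is the transpose of fusion with \<open>a\<close>, which makes \<open>fmul (dual C a)\<close> the
  adjoint of \<open>fmul a\<close>.\<close>

lemma N_adjoint:
  assumes "a \<in> Irr C" "b \<in> Irr C" "c \<in> Irr C"
  shows "Nf C a b c = Nf C (dual C a) c b"
proof -
  have "Nf C a b c = Nf C b (dual C c) (dual C a)"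
    using N_rotate[of a b "dual C c"] assms by simp
  also have "\<dots> = Nf C (dual C c) a (dual C b)"
    using N_rotate[of b "dual C c" a] assms by simp
  also have "\<dots> = Nf C (dual C a) c b"
    using N_dual[of "dual C c" a "dual C b"] assms by simp
  finally show ?thesis .
qed

text \<open>The function \<open>f\<close>, extended linearly, evaluated at the product of
  \<open>a\<close> and \<open>b\<close>. Characters are the common eigenvectors of these operators
  with value 1 at the unit, and \<open>\<chi> a\<close> is the eigenvalue.\<close>

definition fmul :: "'a \<Rightarrow> ('a \<Rightarrow> complex) \<Rightarrow> 'a \<Rightarrow> complex" where
  "fmul a f = (\<lambda>b. if b \<in> Irr C then (\<Sum>c\<in>Irr C. of_nat (Nf C a b c) * f c) else 0)"

definition inner :: "('a \<Rightarrow> complex) \<Rightarrow> ('a \<Rightarrow> complex) \<Rightarrow> complex" where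
  "inner f g = (\<Sum>b\<in>Irr C. f b * cnj (g b))"

lemma fmul_linear: "fmul a (\<lambda>x. c * f x + d * g x) = (\<lambda>x. c * fmul a f x + d * fmul a g x)"
  by (rule ext) (simp add: fmul_def sum_distrib_left sum.distrib[symmetric] algebra_simps)

lemma fmul_commute:
  assumes "a \<in> Irr C" "b \<in> Irr C"
  shows "fmul a (fmul b f) = fmul b (fmul a f)"
proof
  fix d
  have eq: "fmul x (fmul y f) d =
      (\<Sum>e\<in>Irr C. of_nat (\<Sum>c\<in>Irr C. Nf C x d c * Nf C y c e) * f e)" if "d \<in> Irr C" for x y
  proof -
    have "fmul x (fmul y f) d =
        (\<Sum>c\<in>Irr C. \<Sum>e\<in>Irr C. of_nat (Nf C x d c * Nf C y c e) * f e)"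
      using that by (simp add: fmul_def sum_distrib_left mult.assoc)
    also have "\<dots> = (\<Sum>e\<in>Irr C. \<Sum>c\<in>Irr C. of_nat (Nf C x d c * Nf C y c e) * f e)"
      by (rule sum.swap)
    finally show ?thesis by (simp add: sum_distrib_right)
  qed
  have "(\<Sum>c\<in>Irr C. Nf C a d c * Nf C b c e) = (\<Sum>c\<in>Irr C. Nf C b d c * Nf C a c e)"
    if "d \<in> Irr C" "e \<in> Irr C" for e
  proof -
    have "(\<Sum>c\<in>Irr C. Nf C a d c * Nf C b c e) = (\<Sum>c\<in>Irr C. Nf C d a c * Nf C b c e)"
      by (rule sum.cong) (use assms that N_commute in auto)
    also have "\<dots> = (\<Sum>c\<in>Irr C. Nf C b d c * Nf C c a e)"
      using N_assoc[of b d a e] assms that by simp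
    also have "\<dots> = (\<Sum>c\<in>Irr C. Nf C b d c * Nf C a c e)"
      by (rule sum.cong) (use assms that N_commute in auto)
    finally show ?thesis .
  qed
  then have "(\<Sum>e\<in>Irr C. of_nat (\<Sum>c\<in>Irr C. Nf C a d c * Nf C b c e) * f e) =
      (\<Sum>e\<in>Irr C. of_nat (\<Sum>c\<in>Irr C. Nf C b d c * Nf C a c e) * f e)" if "d \<in> Irr C"
    using that by (intro sum.cong) (auto simp del: of_nat_sum)
  then show "fmul a (fmul b f) d = fmul b (fmul a f) d"
    by (cases "d \<in> Irr C") (simp_all only: eq, simp add: fmul_def)
qed

lemma inner_fmul:
  assumes "a \<in> Irr C"
  shows "inner (fmul a f) g = inner f (fmul (dual C a) g)"
proof -
  have "inner (fmul a f) g = (\<Sum>b\<in>Irr C. \<Sum>c\<in>Irr C. of_nat (Nf C a b c) * f c * cnj (g b))"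
    by (simp add: inner_def fmul_def sum_distrib_right)
  also have "\<dots> = (\<Sum>c\<in>Irr C. \<Sum>b\<in>Irr C. of_nat (Nf C a b c) * f c * cnj (g b))"
    by (rule sum.swap)
  also have "\<dots> = (\<Sum>c\<in>Irr C. \<Sum>b\<in>Irr C. of_nat (Nf C (dual C a) c b) * f c * cnj (g b))"
    by (intro sum.cong refl) (simp add: N_adjoint[OF assms])
  also have "\<dots> = inner f (fmul (dual C a) g)"
    by (simp add: inner_def fmul_def sum_distrib_left algebra_simps)
  finally show ?thesis .
qed

lemma inner_linear: "inner (\<lambda>x. c * f x + d * g x) h = c * inner f h + d * inner g h"
  by (simp add: inner_def sum_distrib_left sum.distrib[symmetric] algebra_simps)

lemma inner_self: "inner f f = of_real (\<Sum>a\<in>Irr C. (cmod (f a))\<^sup>2)"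
  by (simp add: inner_def complex_norm_square[symmetric])

lemma character_scale_pos:
  assumes "\<chi> \<in> characters C"
  shows "(\<Sum>a\<in>Irr C. (cmod (\<chi> a))\<^sup>2) > 0" "char_scale C \<chi> > 0"
    "inner \<chi> \<chi> = 1 / of_real ((char_scale C \<chi>)\<^sup>2)"
proof -
  have "(cmod (\<chi> (unit C)))\<^sup>2 \<le> (\<Sum>a\<in>Irr C. (cmod (\<chi> a))\<^sup>2)"
    by (rule member_le_sum) auto
  then show pos: "(\<Sum>a\<in>Irr C. (cmod (\<chi> a))\<^sup>2) > 0" using assms by (auto simp: characters_def)
  then show "char_scale C \<chi> > 0" by (simp add: char_scale_def)
  show "inner \<chi> \<chi> = 1 / of_real ((char_scale C \<chi>)\<^sup>2)"
    using pos unfolding inner_self char_scale_def by (simp add: power_divide sum_nonneg)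
qed

lemma fmul_character:
  assumes "\<chi> \<in> characters C" "a \<in> Irr C"
  shows "fmul a \<chi> = (\<lambda>x. \<chi> a * \<chi> x)"
  using assms by (auto simp: fmul_def characters_def fun_eq_iff)

text \<open>\<open>fmul a\<close> is evaluated on the left by its eigenvalue and, moved across the
  inner product, on the right. Equal characters yield \<open>character_dual\<close>; arbitrary pairs
  then yield orthogonality.\<close>

lemma inner_character_dual:
  assumes "\<chi> \<in> characters C" "\<psi> \<in> characters C" "a \<in> Irr C"
  shows "\<chi> a * inner \<chi> \<psi> = cnj (\<psi> (dual C a)) * inner \<chi> \<psi>"
proof -
  have "\<chi> a * inner \<chi> \<psi> = inner (fmul a \<chi>) \<psi>"
    using inner_linear[of "\<chi> a" \<chi> 0 \<chi>] fmul_character assms by simp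
  also have "\<dots> = inner \<chi> (\<lambda>x. \<psi> (dual C a) * \<psi> x)"
    using inner_fmul[OF assms(3), of \<chi> \<psi>] fmul_character[OF assms(1,3)]
      fmul_character[OF assms(2), of "dual C a"] assms by simp
  also have "\<dots> = cnj (\<psi> (dual C a)) * inner \<chi> \<psi>"
    by (simp add: inner_def sum_distrib_left algebra_simps)
  finally show ?thesis .
qed

lemma character_dual:
  assumes "\<chi> \<in> characters C" "a \<in> Irr C"
  shows "\<chi> (dual C a) = cnj (\<chi> a)"
  using inner_character_dual[OF assms(1,1,2)] character_scale_pos[OF assms(1)] by simp

text \<open>A nonzero inner product could be cancelled in \<open>inner_character_dual\<close>, and
  the two characters would agree everywhere.\<close>

lemma character_orthogonal:
  assumes "\<chi> \<in> characters C" "\<psi> \<in> characters C"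
  shows "inner \<chi> \<psi> = (if \<chi> = \<psi> then 1 / of_real ((char_scale C \<chi>)\<^sup>2) else 0)"
proof (cases "inner \<chi> \<psi> = 0")
  case False
  have "\<chi> a = \<psi> a" for a
  proof (cases "a \<in> Irr C")
    case True
    then show ?thesis
      using inner_character_dual[OF assms True] character_dual[OF assms(2)] False by simp
  qed (use assms in \<open>auto simp: characters_def\<close>)
  then have "\<chi> = \<psi>" by blast
  then show ?thesis using character_scale_pos[OF assms(1)] by simp
qed (use character_scale_pos[OF assms(1)] in auto)

text \<open>Orthogonal nonzero vectors are independent: a linear relation among more than
  \<open>card (Irr C)\<close> characters, paired with one that occurs in it, contradicts the
  positivity of norms.\<close>

lemma finite_characters [simp]: "finite (characters C)"
proof (rule ccontr)
  assume "infinite (characters C)"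
  then obtain J where J: "J \<subseteq> characters C" "card J = Suc (card (Irr C))" "finite J"
    using infinite_arbitrarily_large by blast
  then obtain c \<psi> where c: "\<psi> \<in> J" "c \<psi> \<noteq> 0" "\<And>a. a \<in> Irr C \<Longrightarrow> (\<Sum>\<chi>\<in>J. c \<chi> * \<chi> a) = 0"
    using linear_dependence[of "Irr C" J "\<lambda>\<chi>. \<chi>"] by auto
  have "0 = (\<Sum>a\<in>Irr C. (\<Sum>\<chi>\<in>J. c \<chi> * \<chi> a) * cnj (\<psi> a))" using c by simp
  also have "\<dots> = (\<Sum>a\<in>Irr C. \<Sum>\<chi>\<in>J. c \<chi> * (\<chi> a * cnj (\<psi> a)))"
    by (simp add: sum_distrib_right mult.assoc)
  also have "\<dots> = (\<Sum>\<chi>\<in>J. c \<chi> * inner \<chi> \<psi>)"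
    by (subst sum.swap) (simp add: inner_def sum_distrib_left)
  also have "\<dots> = (\<Sum>\<chi>\<in>J. if \<chi> = \<psi> then c \<psi> * inner \<psi> \<psi> else 0)"
  proof (intro sum.cong refl)
    fix \<chi> assume "\<chi> \<in> J"
    then have "\<chi> \<in> characters C" "\<psi> \<in> characters C" using J c(1) by auto
    then show "c \<chi> * inner \<chi> \<psi> = (if \<chi> = \<psi> then c \<psi> * inner \<psi> \<psi> else 0)"
      using character_orthogonal[of \<chi> \<psi>] by auto
  qed
  also have "\<dots> = c \<psi> * inner \<psi> \<psi>" using J c by simp
  finally show False using c J character_scale_pos[of \<psi>] by auto
qed

section \<open>Completeness of the characters\<close>

lemma common_eigenvector:
  assumes supp: "\<And>f x. f \<in> W \<Longrightarrow> x \<notin> Irr C \<Longrightarrow> f x = 0"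
    and lin: "\<And>f g c d. f \<in> W \<Longrightarrow> g \<in> W \<Longrightarrow> (\<lambda>x. c * f x + d * g x) \<in> W"
    and inv: "\<And>f a. f \<in> W \<Longrightarrow> a \<in> Irr C \<Longrightarrow> fmul a f \<in> W"
    and w: "w \<in> W" "w \<noteq> (\<lambda>_. 0)"
    and "finite A" "A \<subseteq> Irr C"
  shows "\<exists>z. \<exists>f\<in>W. f \<noteq> (\<lambda>_. 0) \<and> (\<forall>a\<in>A. fmul a f = (\<lambda>x. z a * f x))"
  using \<open>finite A\<close> \<open>A \<subseteq> Irr C\<close>
proof (induction A rule: finite_induct)
  case empty
  then show ?case using w by auto
next
  case (insert a A)
  then obtain z f where f: "f \<in> W" "f \<noteq> (\<lambda>_. 0)" "\<forall>a\<in>A. fmul a f = (\<lambda>x. z a * f x)" by auto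
  \<comment> \<open>The joint eigenspace for \<open>A\<close> is nonzero because of
    \<open>f\<close>, and it is stable under \<open>fmul a\<close> since the operators commute; an
    eigenvector of \<open>fmul a\<close> inside it extends the claim to \<open>a\<close>.\<close>
  define V where "V = {f \<in> W. \<forall>a\<in>A. fmul a f = (\<lambda>x. z a * f x)}"
  have "\<exists>y g. g \<in> V \<and> g \<noteq> (\<lambda>_. 0) \<and> fmul a g = (\<lambda>x. y * g x)"
  proof (rule invariant_subspace_eigenvector[of "Irr C" V "fmul a" f])
    show "fmul a g \<in> V" if "g \<in> V" for g
    proof -
      have "fmul b (fmul a g) = (\<lambda>x. z b * fmul a g x)" if "b \<in> A" for b
        using fmul_commute[of b a g] fmul_linear[of a "z b" g 0 g] insert.prems \<open>g \<in> V\<close> that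
        by (auto simp: V_def)
      then show ?thesis using that inv insert.prems by (auto simp: V_def)
    qed
    show "(\<lambda>x. c * g x + d * h x) \<in> V" if "g \<in> V" "h \<in> V" for g h c d
      using that lin by (auto simp: V_def fmul_linear algebra_simps)
  qed (use supp f fmul_linear in \<open>auto simp: V_def\<close>)
  then obtain y g where g: "g \<in> V" "g \<noteq> (\<lambda>_. 0)" "fmul a g = (\<lambda>x. y * g x)" by blast
  then show ?case using insert.hyps
    by (intro exI[of _ "z(a := y)"] bexI[of _ g]) (auto simp: V_def)
qed

text \<open>The eigenvalue equation at the unit reads \<open>f a = z a * f (unit C)\<close>. Hence
  \<open>f (unit C)\<close> is nonzero for nonzero \<open>f\<close>, the normalised function is the
  eigenvalue system, and the eigenvalue equation becomes multiplicativity.\<close>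

lemma eigenvector_character:
  assumes supp: "\<And>x. x \<notin> Irr C \<Longrightarrow> f x = 0" and nz: "f \<noteq> (\<lambda>_. 0)"
    and ev: "\<And>a. a \<in> Irr C \<Longrightarrow> fmul a f = (\<lambda>x. z a * f x)"
  shows "f (unit C) \<noteq> 0" "(\<lambda>x. f x / f (unit C)) \<in> characters C"
proof -
  have fz: "f a = z a * f (unit C)" if a: "a \<in> Irr C" for a
  proof -
    have "fmul a f (unit C) = (\<Sum>c\<in>Irr C. of_nat (Nf C a (unit C) c) * f c)"
      by (simp add: fmul_def)
    also have "\<dots> = (\<Sum>c\<in>Irr C. if c = a then f a else 0)"
      by (rule sum.cong) (use a N_unit_right in auto)
    finally have "fmul a f (unit C) = (\<Sum>c\<in>Irr C. if c = a then f a else 0)" .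
    then show ?thesis using ev a by simp
  qed
  then show u: "f (unit C) \<noteq> 0" using supp nz by (metis ext mult_zero_right)
  have "f a / f (unit C) * (f b / f (unit C)) =
      (\<Sum>c\<in>Irr C. of_nat (Nf C a b c) * (f c / f (unit C)))" if ab: "a \<in> Irr C" "b \<in> Irr C" for a b
  proof -
    have "f a / f (unit C) * (f b / f (unit C)) = fmul a f b / f (unit C)"
      using fz[OF ab(1)] ev[OF ab(1)] u by simp
    then show ?thesis using ab by (simp add: fmul_def sum_divide_distrib)
  qed
  then show "(\<lambda>x. f x / f (unit C)) \<in> characters C"
    using supp u by (auto simp: characters_def)
qed

text \<open>The orthogonal complement \<open>W\<close> of the characters is stable under every
  \<open>fmul a\<close>, because the adjoint operators act on characters by scalars. A nonzero
  \<open>W\<close> would contain a common eigenvector, and its normalisation would be a character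
  orthogonal to itself.\<close>

lemma orthogonal_to_characters:
  assumes supp: "\<And>x. x \<notin> Irr C \<Longrightarrow> w x = 0"
    and orth: "\<And>\<chi>. \<chi> \<in> characters C \<Longrightarrow> inner w \<chi> = 0"
  shows "w = (\<lambda>_. 0)"
proof (rule ccontr)
  assume nz: "w \<noteq> (\<lambda>_. 0)"
  define W where "W = {f. (\<forall>x. x \<notin> Irr C \<longrightarrow> f x = 0) \<and> (\<forall>\<chi>\<in>characters C. inner f \<chi> = 0)}"
  have "\<exists>z. \<exists>f\<in>W. f \<noteq> (\<lambda>_. 0) \<and> (\<forall>a\<in>Irr C. fmul a f = (\<lambda>x. z a * f x))"
  proof (rule common_eigenvector[of W w])
    show "fmul a f \<in> W" if f: "f \<in> W" and a: "a \<in> Irr C" for f a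
    proof -
      have "inner (fmul a f) \<chi> = 0" if "\<chi> \<in> characters C" for \<chi>
      proof -
        have "inner (fmul a f) \<chi> = inner f (\<lambda>x. \<chi> (dual C a) * \<chi> x)"
          using inner_fmul fmul_character a that by simp
        also have "\<dots> = cnj (\<chi> (dual C a)) * inner f \<chi>"
          by (simp add: inner_def sum_distrib_left algebra_simps)
        finally show ?thesis using f that by (simp add: W_def)
      qed
      then show ?thesis by (simp add: W_def fmul_def)
    qed
  qed (use nz supp orth in \<open>auto simp: W_def inner_linear\<close>)
  then obtain z f where f: "f \<in> W" "f \<noteq> (\<lambda>_. 0)" "\<And>a. a \<in> Irr C \<Longrightarrow> fmul a f = (\<lambda>x. z a * f x)"
    by blast
  let ?\<chi> = "\<lambda>x. f x / f (unit C)"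
  have \<chi>: "f (unit C) \<noteq> 0" "?\<chi> \<in> characters C"
    using eigenvector_character[of f z] f by (auto simp: W_def)
  have "inner ?\<chi> ?\<chi> = inner (\<lambda>x. 1 / f (unit C) * f x + 0 * f x) ?\<chi>" by simp
  also have "\<dots> = 0" using f \<chi> unfolding inner_linear by (simp add: W_def)
  finally show False using character_scale_pos[OF \<chi>(2)] by simp
qed

lemma character_complete:
  assumes "a \<in> Irr C" "b \<in> Irr C"
  shows "(\<Sum>\<chi>\<in>characters C. of_real ((char_scale C \<chi>)\<^sup>2) * \<chi> a * cnj (\<chi> b)) =
    (if a = b then 1 else 0)"
proof -
  \<comment> \<open>The delta function at \<open>b\<close> minus its orthogonal expansion in
    characters.\<close>
  define w where "w x = (if x = b then 1 else 0) -
    (\<Sum>\<chi>\<in>characters C. of_real ((char_scale C \<chi>)\<^sup>2) * \<chi> x * cnj (\<chi> b))" for x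
  have "w = (\<lambda>_. 0)"
  proof (rule orthogonal_to_characters)
    fix x assume x: "x \<notin> Irr C"
    then have "\<chi> x = 0" if "\<chi> \<in> characters C" for \<chi> using that by (simp add: characters_def)
    then have "(\<Sum>\<chi>\<in>characters C. of_real ((char_scale C \<chi>)\<^sup>2) * \<chi> x * cnj (\<chi> b)) = 0"
      by (intro sum.neutral) simp
    then show "w x = 0" using x assms unfolding w_def by auto
  next
    fix \<psi> assume \<psi>: "\<psi> \<in> characters C"
    have "inner w \<psi> = (\<Sum>x\<in>Irr C. if x = b then cnj (\<psi> b) else 0) -
      (\<Sum>x\<in>Irr C. \<Sum>\<chi>\<in>characters C. of_real ((char_scale C \<chi>)\<^sup>2) * cnj (\<chi> b) * (\<chi> x * cnj (\<psi> x)))"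
      unfolding inner_def w_def sum_subtractf[symmetric]
      by (rule sum.cong) (auto simp: left_diff_distrib sum_distrib_right right_diff_distrib
          sum_distrib_left mult_ac)
    also have "(\<Sum>x\<in>Irr C. \<Sum>\<chi>\<in>characters C.
        of_real ((char_scale C \<chi>)\<^sup>2) * cnj (\<chi> b) * (\<chi> x * cnj (\<psi> x))) =
      (\<Sum>\<chi>\<in>characters C. of_real ((char_scale C \<chi>)\<^sup>2) * cnj (\<chi> b) * inner \<chi> \<psi>)"
      by (subst sum.swap) (simp add: inner_def sum_distrib_left)
    also have "\<dots> = (\<Sum>\<chi>\<in>characters C. if \<chi> = \<psi> then cnj (\<psi> b) else 0)"
      by (rule sum.cong) (use \<psi> character_orthogonal character_scale_pos(2)[OF \<psi>] in auto)
    finally show "inner w \<psi> = 0" using \<psi> assms by simp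
  qed
  then have "w a = 0" by simp
  then show ?thesis unfolding w_def by auto
qed

end

section \<open>Invariant labelings\<close>

text \<open>One encoding for anyons, with default \<open>unit C\<close>, and for labelings by
  characters, with default the zero function. Fixing the values beyond the layers keeps the set
  finite for finite \<open>B\<close>.\<close>

definition labels :: "nat \<Rightarrow> 'b set \<Rightarrow> 'b \<Rightarrow> (nat \<Rightarrow> 'b) set" where
  "labels n B d = {a. (\<forall>i<n. a i \<in> B) \<and> (\<forall>i\<ge>n. a i = d)}"

definition inv_labels :: "nat \<Rightarrow> (nat \<Rightarrow> nat) \<Rightarrow> 'b set \<Rightarrow> 'b \<Rightarrow> (nat \<Rightarrow> 'b) set" where
  "inv_labels n p B d = {a \<in> labels n B d. \<forall>i. a (p i) = a i}"

lemma anyons_labels: "anyons C n = labels n (Irr C) (unit C)"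
  by (simp add: anyons_def labels_def)

lemma finite_labels:
  assumes "finite B"
  shows "finite (labels n B d)"
proof -
  have "labels n B d \<subseteq> (\<lambda>f i. if i < n then f i else d) ` ({..<n} \<rightarrow>\<^sub>E B)"
  proof
    fix a assume "a \<in> labels n B d"
    then have "a = (\<lambda>i. if i < n then restrict a {..<n} i else d)" "restrict a {..<n} \<in> {..<n} \<rightarrow>\<^sub>E B"
      by (auto simp: labels_def)
    then show "a \<in> (\<lambda>f i. if i < n then f i else d) ` ({..<n} \<rightarrow>\<^sub>E B)" by blast
  qed
  then show ?thesis using assms by (meson finite_PiE finite_imageI finite_lessThan finite_subset)
qed

lemma finite_inv_labels: "finite B \<Longrightarrow> finite (inv_labels n p B d)"
  by (simp add: inv_labels_def finite_labels)

lemma inv_labels_id [simp]: "inv_labels n id B d = labels n B d"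
  by (simp add: inv_labels_def)

lemma fixed_by_iff:
  assumes p: "p permutes {..<n}" and a: "a \<in> labels n B d"
  shows "fixed_by n p a \<longleftrightarrow> (\<forall>i. a (p i) = a i)"
proof
  assume f: "fixed_by n p a"
  show "\<forall>i. a (p i) = a i"
  proof
    fix i
    show "a (p i) = a i"
    proof (cases "i < n")
      case True
      then show ?thesis using f orbit_in_orbits[OF p True] orbit_of_step[of i p i]
        unfolding fixed_by_def by (meson orbit_of_self)
    next
      case False
      then show ?thesis using p by (simp add: permutes_not_in)
    qed
  qed
next
  assume "\<forall>i. a (p i) = a i"
  then have "a x = a i" if "x \<in> orbit_of p i" for x i using invariant_on_orbit[of a p x i] that by simp
  then show "fixed_by n p a" unfolding fixed_by_def orbits_def by (metis imageE)
qed

lemma dbasis_iff: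
  "(p, a) \<in> dbasis C n \<longleftrightarrow> p permutes {..<n} \<and> a \<in> inv_labels n p (Irr C) (unit C)"
  using fixed_by_iff[of p n a] by (auto simp: dbasis_def perms_def anyons_labels inv_labels_def)

text \<open>An invariant labeling is a free choice of one element of \<open>B\<close> for each
  orbit, with \<open>?h\<close> and \<open>?k\<close> as translations; the rest is distributivity.
  Sums over \<sigma>-fixed anyons and over \<sigma>-invariant labelings both factor this
  way.\<close>

lemma sum_inv_labels:
  fixes g :: "nat set \<Rightarrow> 'b \<Rightarrow> 'c::comm_semiring_1"
  assumes p: "p permutes {..<n}" and B: "finite B"
  shows "(\<Sum>a\<in>inv_labels n p B d. \<Prod>Q\<in>orbits n p. g Q (a (Min Q))) = (\<Prod>Q\<in>orbits n p. \<Sum>x\<in>B. g Q x)"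
proof -
  let ?h = "\<lambda>\<phi> i. if i < n then \<phi> (orbit_of p i) else d"
  let ?k = "\<lambda>a. restrict (\<lambda>Q. a (Min Q)) (orbits n p)"
  have min: "orbit_of p (Min Q) = Q" "Min Q < n" if "Q \<in> orbits n p" for Q
    using orbit_eq_orbit_of[OF p that orbit_Min_in[OF p that]]
      orbit_less[OF p that orbit_Min_in[OF p that]] by auto
  have pn: "p i < n \<longleftrightarrow> i < n" for i using permutes_in_image[OF p] by simp
  have po: "orbit_of p (p i) = orbit_of p i" for i
    using orbit_of_eq[OF p, of "p i" i] orbit_of_step[of i p i] by simp
  have "(\<Prod>Q\<in>orbits n p. \<Sum>x\<in>B. g Q x) = (\<Sum>\<phi>\<in>orbits n p \<rightarrow>\<^sub>E B. \<Prod>Q\<in>orbits n p. g Q (\<phi> Q))"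
    by (rule prod_sum_PiE) (use B finite_orbits[OF p] in auto)
  also have "\<dots> = (\<Sum>a\<in>inv_labels n p B d. \<Prod>Q\<in>orbits n p. g Q (a (Min Q)))"
  proof (rule sum.reindex_bij_witness[where i = ?k and j = ?h])
    fix \<phi> assume \<phi>: "\<phi> \<in> orbits n p \<rightarrow>\<^sub>E B"
    show "?k (?h \<phi>) = \<phi>"
    proof
      fix Q
      show "?k (?h \<phi>) Q = \<phi> Q"
        by (cases "Q \<in> orbits n p") (use min \<phi> in \<open>auto simp: PiE_def extensional_def\<close>)
    qed
    show "?h \<phi> \<in> inv_labels n p B d"
      using \<phi> orbit_in_orbits[OF p] by (auto simp: inv_labels_def labels_def pn po)
    show "(\<Prod>Q\<in>orbits n p. g Q (?h \<phi> (Min Q))) = (\<Prod>Q\<in>orbits n p. g Q (\<phi> Q))"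
      by (rule prod.cong) (use min in auto)
  next
    fix a assume a: "a \<in> inv_labels n p B d"
    then have ap: "a (p i) = a i" for i by (simp add: inv_labels_def)
    show "?h (?k a) = a"
    proof
      fix i
      show "?h (?k a) i = a i"
      proof (cases "i < n")
        case True
        have "a (Min (orbit_of p i)) = a i"
          using invariant_on_orbit[of a p "Min (orbit_of p i)" i] ap
            orbit_Min_in[OF p orbit_in_orbits[OF p True]] by simp
        then show ?thesis using True orbit_in_orbits[OF p True] by simp
      qed (use a in \<open>simp add: inv_labels_def labels_def\<close>)
    qed
    show "?k a \<in> orbits n p \<rightarrow>\<^sub>E B"
      using a min by (auto simp: inv_labels_def labels_def)
  qed
  finally show ?thesis by simp
qed

lemma prod_orbits_id: "(\<Prod>Q\<in>orbits n id. g (Min Q)) = prod g {..<n}"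
  for g :: "nat \<Rightarrow> 'c::comm_monoid_mult"
  unfolding orbits_id by (subst prod.reindex) (auto simp: inj_on_def)

lemma sum_labels:
  fixes g :: "nat \<Rightarrow> 'b \<Rightarrow> 'c::comm_semiring_1"
  assumes B: "finite B"
  shows "(\<Sum>a\<in>labels n B d. \<Prod>i<n. g i (a i)) = (\<Prod>i<n. \<Sum>x\<in>B. g i x)"
proof -
  have "(\<Prod>Q\<in>orbits n id. g (Min Q) (a (Min Q))) = (\<Prod>i<n. g i (a i))" for a
    by (rule prod_orbits_id)
  moreover have "(\<Prod>Q\<in>orbits n id. \<Sum>x\<in>B. g (Min Q) x) = (\<Prod>i<n. \<Sum>x\<in>B. g i x)"
    by (rule prod_orbits_id)
  ultimately show ?thesis
    using sum_inv_labels[OF permutes_id B, where n = n and d = d and g = "\<lambda>Q. g (Min Q)"] by simp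
qed

lemma orbit_weight_id: "orbit_weight n id f = prod f {..<n}"
  unfolding orbit_weight_def by (rule prod_orbits_id)

lemma orbit_weight_mult: "orbit_weight n p (\<lambda>i. f i * g i) = orbit_weight n p f * orbit_weight n p g"
  unfolding orbit_weight_def by (rule prod.distrib)

lemma orbit_of_inv:
  fixes n :: nat
  assumes p: "p permutes {..<n}"
  shows "orbit_of (inv p) i = orbit_of p i"
proof
  have q: "inv p permutes {..<n}" using p by (rule permutes_inv)
  have *: "orbit_of (inv q) i \<subseteq> orbit_of q i" if q: "q permutes {..<n}" for q
  proof (rule orbit_of_subset)
    fix x assume x: "x \<in> orbit_of q i"
    have "x \<in> orbit_of q (inv q x)"
      using orbit_of_funpow[of 1 q "inv q x"] permutes_inverses(1)[OF q] by simp
    then show "inv q x \<in> orbit_of q i"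
      using orbit_of_sym[OF q] x orbit_of_trans by blast
  qed simp
  show "orbit_of (inv p) i \<subseteq> orbit_of p i" using *[OF p] .
  show "orbit_of p i \<subseteq> orbit_of (inv p) i"
    using *[OF q] permutes_inv_inv[OF p] by simp
qed

lemma orbit_weight_inv:
  "p permutes {..<n} \<Longrightarrow> orbit_weight n (inv p) f = orbit_weight n p f"
  by (simp add: orbit_weight_def orbits_def orbit_of_inv)

lemma invariant_inv_iff:
  "p permutes A \<Longrightarrow> (\<forall>i. s (inv p i) = s i) \<longleftrightarrow> (\<forall>i. s (p i) = s i)"
  by (metis permutes_inverses)

lemma orbit_weight_conj:
  fixes n :: nat
  assumes r: "r permutes {..<n}" and p: "p permutes {..<n}" and f: "\<And>i. f (p i) = f i"
  shows "orbit_weight n (r \<circ> p \<circ> inv r) (f \<circ> inv r) = orbit_weight n p f"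
proof -
  let ?q = "r \<circ> p \<circ> inv r"
  have ir: "inv r (r x) = x" "r (inv r x) = x" for x
    using permutes_inverses[OF r] by auto
  have "(?q ^^ k) (r i) = r ((p ^^ k) i)" for k i by (induction k) (simp_all add: ir)
  then have orb: "orbit_of ?q (r i) = r ` orbit_of p i" for i by (auto simp: orbit_of_def)
  have "orbits n ?q = orbit_of ?q ` (r ` {..<n})"
    using permutes_image[OF r] by (simp add: orbits_def)
  also have "\<dots> = (`) r ` orbits n p" unfolding orbits_def image_image orb ..
  finally have orbs: "orbits n ?q = (`) r ` orbits n p" .
  have inj: "inj_on ((`) r) (orbits n p)"
    using permutes_inj[OF r] by (auto simp: inj_on_def inj_image_eq_iff)
  \<comment> \<open>\<open>r\<close> need not preserve least elements, but \<open>f\<close> is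
    constant on \<open>Q\<close>, so the change of representative is harmless.\<close>
  have "f (inv r (Min (r ` Q))) = f (Min Q)" if Q: "Q \<in> orbits n p" for Q
  proof -
    have "Min (r ` Q) \<in> r ` Q"
      using orbit_finite[OF p Q] orbit_Min_in[OF p Q] by (intro Min_in) auto
    then have "inv r (Min (r ` Q)) \<in> Q" by (auto simp: ir)
    then have "inv r (Min (r ` Q)) \<in> orbit_of p (Min Q)"
      using orbit_eq_orbit_of[OF p Q orbit_Min_in[OF p Q]] by simp
    then show ?thesis using invariant_on_orbit[of f p] f by blast
  qed
  then show ?thesis unfolding orbit_weight_def orbs by (simp add: prod.reindex[OF inj])
qed

section \<open>Evaluation at labelings by characters\<close>

locale fusion_layers = fusion C for C :: "'a fusion_data" +
  fixes n :: nat
begin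

abbreviation Fix :: "(nat \<Rightarrow> nat) \<Rightarrow> (nat \<Rightarrow> 'a) set" where
  "Fix p \<equiv> inv_labels n p (Irr C) (unit C)"

abbreviation Lab :: "(nat \<Rightarrow> 'a \<Rightarrow> complex) set" where
  "Lab \<equiv> labels n (characters C) (\<lambda>_. 0)"

abbreviation scale :: "(nat \<Rightarrow> 'a \<Rightarrow> complex) \<Rightarrow> nat \<Rightarrow> complex" where
  "scale s \<equiv> (\<lambda>i. of_real (char_scale C (s i)))"

text \<open>The linear extension of the tensor product of the characters \<open>s i\<close>; for
  \<open>s \<in> Lab\<close> it is a character of the multilayer fusion ring.\<close>

definition hat :: "(nat \<Rightarrow> 'a \<Rightarrow> complex) \<Rightarrow> ((nat \<Rightarrow> 'a) \<Rightarrow> int) \<Rightarrow> complex" where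
  "hat s x = (\<Sum>a\<in>anyons C n. of_int (x a) * (\<Prod>i<n. s i (a i)))"

lemma finite_anyons [simp]: "finite (anyons C n)"
  by (simp add: anyons_labels finite_labels)

lemma Lab_character: "s \<in> Lab \<Longrightarrow> i < n \<Longrightarrow> s i \<in> characters C"
  by (simp add: labels_def)

lemma character_mult:
  "\<chi> \<in> characters C \<Longrightarrow> a \<in> Irr C \<Longrightarrow> b \<in> Irr C \<Longrightarrow>
    \<chi> a * \<chi> b = (\<Sum>c\<in>Irr C. of_nat (Nf C a b c) * \<chi> c)"
  and character_unit [simp]: "\<chi> \<in> characters C \<Longrightarrow> \<chi> (unit C) = 1"
  by (auto simp: characters_def)

lemma scale_nonzero: "s \<in> Lab \<Longrightarrow> i < n \<Longrightarrow> scale s i \<noteq> 0"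
  using character_scale_pos(2)[OF Lab_character] by force

lemma orbit_weight_scale_nonzero:
  assumes p: "p permutes {..<n}" and s: "s \<in> Lab"
  shows "orbit_weight n p (scale s) \<noteq> 0"
proof -
  have "scale s (Min Q) \<noteq> 0" if "Q \<in> orbits n p" for Q
    by (rule scale_nonzero[OF s orbit_less[OF p that orbit_Min_in[OF p that]]])
  then show ?thesis unfolding orbit_weight_def by (simp add: finite_orbits[OF p])
qed

lemma hat_tprod:
  assumes s: "s \<in> Lab"
  shows "hat s (tprod C n x y) = hat s x * hat s y"
proof -
  let ?A = "anyons C n"
  have mult: "(\<Sum>c\<in>?A. \<Prod>i<n. of_nat (Nf C (a i) (b i) (c i)) * s i (c i)) =
      (\<Prod>i<n. s i (a i)) * (\<Prod>i<n. s i (b i))" if "a \<in> ?A" "b \<in> ?A" for a b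
  proof -
    have "(\<Sum>c\<in>?A. \<Prod>i<n. of_nat (Nf C (a i) (b i) (c i)) * s i (c i)) =
        (\<Prod>i<n. \<Sum>c\<in>Irr C. of_nat (Nf C (a i) (b i) c) * s i c)"
      unfolding anyons_labels by (rule sum_labels) simp
    also have "\<dots> = (\<Prod>i<n. s i (a i) * s i (b i))"
      by (rule prod.cong[OF refl]) (use character_mult Lab_character[OF s] that in \<open>simp add: anyons_def\<close>)
    finally show ?thesis by (simp add: prod.distrib)
  qed
  have "hat s (tprod C n x y) = (\<Sum>c\<in>?A. \<Sum>a\<in>?A. \<Sum>b\<in>?A. of_int (x a) * of_int (y b) *
      (\<Prod>i<n. of_nat (Nf C (a i) (b i) (c i)) * s i (c i)))"
    by (simp add: hat_def tprod_def sum_distrib_right prod.distrib mult.assoc)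
  also have "\<dots> = (\<Sum>a\<in>?A. \<Sum>c\<in>?A. \<Sum>b\<in>?A. of_int (x a) * of_int (y b) *
      (\<Prod>i<n. of_nat (Nf C (a i) (b i) (c i)) * s i (c i)))"
    by (rule sum.swap)
  also have "\<dots> = (\<Sum>a\<in>?A. \<Sum>b\<in>?A. \<Sum>c\<in>?A. of_int (x a) * of_int (y b) *
      (\<Prod>i<n. of_nat (Nf C (a i) (b i) (c i)) * s i (c i)))"
    by (rule sum.cong[OF refl]) (rule sum.swap)
  also have "\<dots> = (\<Sum>a\<in>?A. \<Sum>b\<in>?A. of_int (x a) * of_int (y b) *
      ((\<Prod>i<n. s i (a i)) * (\<Prod>i<n. s i (b i))))"
    by (intro sum.cong refl) (simp only: sum_distrib_left[symmetric] mult)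
  also have "\<dots> = hat s x * hat s y"
    unfolding hat_def sum_product by (intro sum.cong refl) (simp add: mult_ac)
  finally show ?thesis .
qed

lemma unit_anyon: "(\<lambda>_. unit C) \<in> anyons C n"
  by (simp add: anyons_def)

lemma hat_tunit:
  assumes "s \<in> Lab"
  shows "hat s (tunit C) = 1"
proof -
  have "hat s (tunit C) = (\<Sum>a\<in>anyons C n. if a = (\<lambda>_. unit C) then 1 else 0)"
    unfolding hat_def tunit_def
    by (rule sum.cong) (use Lab_character[OF assms] in \<open>auto intro!: prod.neutral\<close>)
  then show ?thesis using unit_anyon by simp
qed

text \<open>Characters take conjugate values on duals and the value 1 on the unit, so the sum is the
  inner product of \<open>s i\<close> and \<open>s j\<close>, and orthogonality applies.\<close>

lemma hat_Omega:
  assumes s: "s \<in> Lab" and ij: "i < n" "j < n" "i \<noteq> j"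
  shows "hat s (Omega C n i j) = (if s i = s j then 1 / (scale s i)\<^sup>2 else 0)"
proof -
  define e where "e c = (\<lambda>k. if k = i then c else if k = j then dual C c else unit C)" for c
  have e: "e c \<in> anyons C n" if "c \<in> Irr C" for c
    using that ij by (auto simp: e_def anyons_def)
  have inj: "inj_on e (Irr C)" by (rule inj_onI) (metis e_def)
  have prod: "(\<Prod>k<n. s k (e c k)) = s i c * cnj (s j c)" if c: "c \<in> Irr C" for c
  proof -
    have "(\<Prod>k<n. s k (e c k)) =
        (\<Prod>k<n. (if k = i then s i c else 1) * (if k = j then s j (dual C c) else 1))"
      by (rule prod.cong) (use ij Lab_character[OF s] in \<open>auto simp: e_def\<close>)
    then show ?thesis using ij c character_dual[OF Lab_character[OF s]] by (simp add: prod.distrib)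
  qed
  have "hat s (Omega C n i j) = (\<Sum>a\<in>anyons C n. if a \<in> e ` Irr C then \<Prod>k<n. s k (a k) else 0)"
    unfolding hat_def by (rule sum.cong) (auto simp: Omega_def e_def[symmetric])
  also have "\<dots> = (\<Sum>a\<in>e ` Irr C. \<Prod>k<n. s k (a k))"
    by (rule sum.mono_neutral_cong_right) (use e in auto)
  also have "\<dots> = (\<Sum>c\<in>Irr C. s i c * cnj (s j c))"
    by (subst sum.reindex[OF inj]) (auto intro!: sum.cong prod)
  also have "\<dots> = inner (s i) (s j)" by (simp add: inner_def)
  finally show ?thesis using character_orthogonal[OF Lab_character Lab_character, OF s ij(1) s ij(2)]
    by simp
qed

lemma sum_Nlist:
  assumes "\<chi> \<in> characters C" "set xs \<subseteq> Irr C"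
  shows "(\<Sum>c\<in>Irr C. of_nat (Nlist C xs c) * \<chi> c) = prod_list (map \<chi> xs)"
  using assms(2)
proof (induction xs)
  case Nil
  have "(\<Sum>c\<in>Irr C. of_nat (Nlist C [] c) * \<chi> c) = (\<Sum>c\<in>Irr C. if c = unit C then 1 else 0)"
    by (rule sum.cong) (use assms(1) in auto)
  then show ?case by simp
next
  case (Cons x xs)
  have "(\<Sum>c\<in>Irr C. of_nat (Nlist C (x # xs) c) * \<chi> c) =
      (\<Sum>c\<in>Irr C. \<Sum>e\<in>Irr C. of_nat (Nlist C xs e) * (of_nat (Nf C x e c) * \<chi> c))"
    by (simp add: sum_distrib_right sum_distrib_left mult_ac)
  also have "\<dots> = (\<Sum>e\<in>Irr C. of_nat (Nlist C xs e) * (\<Sum>c\<in>Irr C. of_nat (Nf C x e c) * \<chi> c))"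
    by (subst sum.swap) (simp add: sum_distrib_left)
  also have "\<dots> = (\<Sum>e\<in>Irr C. of_nat (Nlist C xs e) * (\<chi> x * \<chi> e))"
    by (rule sum.cong) (use character_mult[OF assms(1)] Cons.prems in auto)
  also have "\<dots> = \<chi> x * (\<Sum>e\<in>Irr C. of_nat (Nlist C xs e) * \<chi> e)"
    by (simp add: sum_distrib_left mult_ac)
  finally show ?case using Cons by simp
qed

lemma invariant_Min:
  assumes p: "p permutes {..<n}" and s: "\<And>i. s (p i) = s i" and "Q \<in> orbits n p" "i \<in> Q"
  shows "s (Min Q) = s i"
  using invariant_on_orbit[of s p "Min Q" i] s orbit_Min_in[OF p assms(3)]
    orbit_eq_orbit_of[OF p assms(3,4)] by simp

text \<open>On an invariant labeling all layers of an orbit carry the same character, which is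
  multiplicative on the fusion product of their entries.\<close>

lemma sum_conf:
  assumes p: "p permutes {..<n}" and s: "s \<in> Lab" "\<And>i. s (p i) = s i" and a: "a \<in> anyons C n"
  shows "(\<Sum>b\<in>Fix p. of_int (conf C n p a b) * orbit_weight n p (\<lambda>i. s i (b i))) = (\<Prod>i<n. s i (a i))"
proof -
  let ?N = "\<lambda>Q. Nlist C (map a (sorted_list_of_set Q))"
  have "(\<Sum>b\<in>Fix p. of_int (conf C n p a b) * orbit_weight n p (\<lambda>i. s i (b i))) =
      (\<Sum>b\<in>Fix p. \<Prod>Q\<in>orbits n p. of_nat (?N Q (b (Min Q))) * s (Min Q) (b (Min Q)))"
    by (simp add: conf_def orbit_weight_def prod.distrib)
  also have "\<dots> = (\<Prod>Q\<in>orbits n p. \<Sum>c\<in>Irr C. of_nat (?N Q c) * s (Min Q) c)"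
    by (rule sum_inv_labels[OF p]) simp
  also have "\<dots> = (\<Prod>Q\<in>orbits n p. \<Prod>i\<in>Q. s i (a i))"
  proof (rule prod.cong[OF refl])
    fix Q assume Q: "Q \<in> orbits n p"
    note fin = orbit_finite[OF p Q]
    have "(\<Sum>c\<in>Irr C. of_nat (?N Q c) * s (Min Q) c) =
        prod_list (map (s (Min Q)) (map a (sorted_list_of_set Q)))"
      by (rule sum_Nlist) (use Lab_character[OF s(1)] orbit_less[OF p Q] orbit_Min_in[OF p Q] fin a
            in \<open>auto simp: anyons_def\<close>)
    also have "\<dots> = (\<Prod>i\<in>Q. s (Min Q) (a i))"
      using prod.distinct_set_conv_list[of "sorted_list_of_set Q" "\<lambda>i. s (Min Q) (a i)"] fin
      by (simp add: comp_def)
    also have "\<dots> = (\<Prod>i\<in>Q. s i (a i))"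
      by (rule prod.cong[OF refl]) (simp add: invariant_Min[where s = s, OF p s(2) Q])
    finally show "(\<Sum>c\<in>Irr C. of_nat (?N Q c) * s (Min Q) c) = (\<Prod>i\<in>Q. s i (a i))" .
  qed
  finally show ?thesis by (simp add: prod_over_orbits[OF p])
qed

text \<open>Confinement does not change the evaluation at \<open>p\<close>-invariant labelings: on
  the left the confined element is evaluated with one character per orbit, on the right the original
  one with one character per layer.\<close>

lemma sum_conf_elem:
  assumes p: "p permutes {..<n}" and s: "s \<in> Lab" "\<And>i. s (p i) = s i"
  shows "(\<Sum>b\<in>Fix p. of_int (conf_elem C n p x b) * orbit_weight n p (\<lambda>i. s i (b i))) = hat s x"
proof -
  let ?w = "\<lambda>b. orbit_weight n p (\<lambda>i. s i (b i))"
  have fx: "b \<in> anyons C n \<and> fixed_by n p b" if "b \<in> Fix p" for b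
    using that fixed_by_iff[OF p, of b "Irr C" "unit C"] by (auto simp: inv_labels_def anyons_labels)
  have "(\<Sum>b\<in>Fix p. of_int (conf_elem C n p x b) * ?w b) =
      (\<Sum>b\<in>Fix p. \<Sum>a\<in>anyons C n. of_int (x a) * (of_int (conf C n p a b) * ?w b))"
    by (rule sum.cong) (auto simp: conf_elem_def fx sum_distrib_right mult.assoc)
  also have "\<dots> = (\<Sum>a\<in>anyons C n. \<Sum>b\<in>Fix p. of_int (x a) * (of_int (conf C n p a b) * ?w b))"
    by (rule sum.swap)
  also have "\<dots> = (\<Sum>a\<in>anyons C n. of_int (x a) * (\<Prod>i<n. s i (a i)))"
    by (rule sum.cong) (simp_all only: sum_distrib_left[symmetric] sum_conf[OF p s])
  finally show ?thesis by (simp add: hat_def)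
qed

text \<open>Each transposition multiplies evaluation times weight by the inverse of
  \<open>scale s i\<close>: a split raises the weight by \<open>scale s i\<close> while
  \<open>Omega\<close> contributes its inverse square, and a merge lowers the weight while the
  factor is trivial. Invariance is assumed only for the final permutation and passes to the earlier
  ones as long as \<open>s i = s j\<close>.\<close>

lemma hat_Fprod:
  assumes ts: "\<And>t. t \<in> set ts \<Longrightarrow> fst t < n \<and> snd t < n \<and> fst t \<noteq> snd t"
    and p: "p permutes {..<n}" and s: "s \<in> Lab" "\<And>i. s (pi_after ts p i) = s i"
  shows "hat s (Fprod C n ts p) * orbit_weight n (pi_after ts p) (scale s) * (\<Prod>t\<leftarrow>ts. scale s (fst t)) =
    (if \<forall>t\<in>set ts. s (fst t) = s (snd t) then orbit_weight n p (scale s) else 0)"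
  using ts s(2)
proof (induction ts)
  case Nil
  then show ?case using hat_tunit[OF s(1)] by simp
next
  case (Cons t ts)
  obtain i j where t: "t = (i, j)" by (cases t)
  define q where "q = pi_after ts p"
  have ij: "i < n" "j < n" "i \<noteq> j" using Cons.prems(1)[of t] t by auto
  have q: "q permutes {..<n}"
    unfolding q_def by (rule pi_after_permutes[OF _ p]) (use Cons.prems(1) in auto)
  have tq: "pi_after (t # ts) p = transp i j \<circ> q" by (simp add: t q_def)
  have inv: "s ((transp i j \<circ> q) x) = s x" for x using Cons.prems(2) unfolding tq by blast
  let ?W = "if j \<in> orbit_of q i then Omega C n i j else tunit C"
  have F: "hat s (Fprod C n (t # ts) p) = hat s ?W * hat s (Fprod C n ts p)"
    unfolding Fprod.simps t fst_conv snd_conv q_def[symmetric] by (rule hat_tprod[OF s(1)])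
  show ?case
  proof (cases "s i = s j")
    case False
    \<comment> \<open>In different orbits of \<open>q\<close>, the layers \<open>i\<close> and
      \<open>j\<close> would be joined by the transposition, and invariance would force
      \<open>s i = s j\<close>. So the factor is \<open>Omega\<close>, and it vanishes.\<close>
    have "j \<in> orbit_of q i"
    proof (rule ccontr)
      assume "j \<notin> orbit_of q i"
      then have "j \<in> orbit_of (transp i j \<circ> q) i" using transp_merge[OF q ij] by simp
      then show False using invariant_on_orbit[of s "transp i j \<circ> q" j i] inv False by simp
    qed
    then have "hat s ?W = 0" using hat_Omega[OF s(1) ij] False by simp
    then show ?thesis unfolding F using False t by simp
  next
    case True
    have "s (transp i j x) = s x" for x using True by (simp add: transp_def)
    then have sq: "s (q x) = s x" for x using inv[of x] by simp
    then have f: "scale s (q x) = scale s x" "scale s i = scale s j" for x using True by simp_all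
    have nz: "scale s i \<noteq> 0" by (rule scale_nonzero[OF s(1) ij(1)])
    have IH: "hat s (Fprod C n ts p) * orbit_weight n q (scale s) * (\<Prod>t\<leftarrow>ts. scale s (fst t)) =
      (if \<forall>t\<in>set ts. s (fst t) = s (snd t) then orbit_weight n p (scale s) else 0)"
      unfolding q_def by (rule Cons.IH) (use Cons.prems(1) sq in \<open>auto simp: q_def\<close>)
    have "hat s ?W * orbit_weight n (transp i j \<circ> q) (scale s) * scale s i = orbit_weight n q (scale s)"
    proof (cases "j \<in> orbit_of q i")
      case split: True
      have w: "orbit_weight n (transp i j \<circ> q) (scale s) = scale s i * orbit_weight n q (scale s)"
        by (rule orbit_weight_split[OF q ij f split])
      have "hat s ?W = 1 / (scale s i)\<^sup>2" using hat_Omega[OF s(1) ij] True split by simp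
      then show ?thesis unfolding w using nz by (simp add: power2_eq_square)
    next
      case merge: False
      have w: "orbit_weight n q (scale s) = scale s i * orbit_weight n (transp i j \<circ> q) (scale s)"
        by (rule orbit_weight_merge[OF q ij f merge])
      show ?thesis unfolding w using merge hat_tunit[OF s(1)] by simp
    qed
    then have eq: "hat s (Fprod C n (t # ts) p) * orbit_weight n (pi_after (t # ts) p) (scale s) *
        (\<Prod>t\<leftarrow>t # ts. scale s (fst t)) =
      hat s (Fprod C n ts p) * orbit_weight n q (scale s) * (\<Prod>t\<leftarrow>ts. scale s (fst t))"
      unfolding F tq by (simp add: t mult_ac)
    show ?thesis unfolding eq IH using True by (simp add: t)
  qed
qed

text \<open>The defect factor is a coboundary up to the constraint that the labeling be invariant: this
  is what makes the product associative.\<close>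

lemma hat_Fmap:
  assumes r: "r permutes {..<n}" and p: "p permutes {..<n}"
    and s: "s \<in> Lab" "\<And>i. s ((r \<circ> p) i) = s i"
  shows "hat s (Fmap C n r p) * orbit_weight n (r \<circ> p) (scale s) * prod (scale s) {..<n} =
    (if \<forall>i. s (r i) = s i then orbit_weight n r (scale s) * orbit_weight n p (scale s) else 0)"
proof -
  let ?ts = "transp_decomp n r"
  let ?P = "\<Prod>t\<leftarrow>?ts. scale s (fst t)"
  have F: "hat s (Fmap C n r p) * orbit_weight n (r \<circ> p) (scale s) * ?P =
      (if \<forall>i. s (r i) = s i then orbit_weight n p (scale s) else 0)"
    unfolding Fmap_def pi_after_transp_decomp[OF r, symmetric] invariant_transp_decomp[OF r, symmetric]
    by (rule hat_Fprod[OF _ p s(1)])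
       (use transp_decomp_bounds[OF r] s(2) pi_after_transp_decomp[OF r] in auto)
  show ?thesis
  proof (cases "\<forall>i. s (r i) = s i")
    case True
    then have "?P * orbit_weight n r (scale s) = prod (scale s) {..<n}"
      by (intro prod_transp_decomp[OF r]) simp
    then have "hat s (Fmap C n r p) * orbit_weight n (r \<circ> p) (scale s) * prod (scale s) {..<n} =
        hat s (Fmap C n r p) * orbit_weight n (r \<circ> p) (scale s) * ?P * orbit_weight n r (scale s)"
      by (simp only: mult.assoc)
    then show ?thesis unfolding F using True by simp
  next
    case False
    have "?P \<noteq> 0"
      using transp_decomp_bounds(1)[OF r] scale_nonzero[OF s(1)] by (auto simp: prod_list_zero_iff)
    then have "hat s (Fmap C n r p) * orbit_weight n (r \<circ> p) (scale s) = 0"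
      using F False by auto
    then show ?thesis unfolding if_not_P[OF False] by simp
  qed
qed

section \<open>Separation by invariant labelings and existence of deconfinements\<close>

lemma sum_scale_character:
  assumes p: "p permutes {..<n}" and a: "a \<in> Fix p" and b: "b \<in> Fix p"
  shows "(\<Sum>s\<in>inv_labels n p (characters C) (\<lambda>_. 0).
      orbit_weight n p (\<lambda>i. (scale s i)\<^sup>2 * s i (a i) * cnj (s i (b i)))) = (if a = b then 1 else 0)"
proof -
  have Irr: "a i \<in> Irr C" "b i \<in> Irr C" for i
    using a b by (cases "i < n"; simp add: inv_labels_def labels_def)+
  \<comment> \<open>The sum splits into one completeness relation of the characters for each
    orbit.\<close>
  have "(\<Sum>s\<in>inv_labels n p (characters C) (\<lambda>_. 0).
      orbit_weight n p (\<lambda>i. (scale s i)\<^sup>2 * s i (a i) * cnj (s i (b i)))) =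
    (\<Prod>Q\<in>orbits n p. \<Sum>\<chi>\<in>characters C.
      (of_real (char_scale C \<chi>))\<^sup>2 * \<chi> (a (Min Q)) * cnj (\<chi> (b (Min Q))))"
    unfolding orbit_weight_def by (rule sum_inv_labels[OF p finite_characters])
  also have "\<dots> = (\<Prod>Q\<in>orbits n p. if a (Min Q) = b (Min Q) then 1 else 0)"
    using character_complete[OF Irr] by simp
  also have "\<dots> = (if a = b then 1 else 0)"
  proof (cases "a = b")
    case False
    then obtain i where i: "a i \<noteq> b i" by blast
    have "i < n"
    proof (rule ccontr)
      assume "\<not> i < n"
      then have "a i = unit C" "b i = unit C" using a b by (auto simp: inv_labels_def labels_def)
      then show False using i by simp
    qed
    then have Q: "orbit_of p i \<in> orbits n p" by (rule orbit_in_orbits[OF p])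
    have "a (Min (orbit_of p i)) = a i" "b (Min (orbit_of p i)) = b i"
      using a b by (auto intro!: invariant_Min[OF p _ Q] simp: inv_labels_def)
    then have "(\<Prod>Q\<in>orbits n p. if a (Min Q) = b (Min Q) then 1 else (0::complex)) = 0"
      using i by (intro prod_zero[OF finite_orbits[OF p]] bexI[OF _ Q]) simp
    then show ?thesis using False by simp
  qed simp
  finally show ?thesis .
qed

text \<open>Inversion formula: pairing with the conjugate weight of \<open>b\<close>, rescaled by
  the squares of \<open>scale s\<close>, extracts the coefficient \<open>f b\<close>.\<close>

lemma weights_independent:
  fixes f :: "(nat \<Rightarrow> 'a) \<Rightarrow> complex"
  assumes p: "p permutes {..<n}" and b: "b \<in> Fix p"
    and 0: "\<And>s. s \<in> inv_labels n p (characters C) (\<lambda>_. 0) \<Longrightarrow>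
      (\<Sum>a\<in>Fix p. f a * orbit_weight n p (\<lambda>i. s i (a i))) = 0"
  shows "f b = 0"
proof -
  let ?S = "inv_labels n p (characters C) (\<lambda>_. 0)"
  have "0 = (\<Sum>s\<in>?S. orbit_weight n p (\<lambda>i. (scale s i)\<^sup>2 * cnj (s i (b i))) *
      (\<Sum>a\<in>Fix p. f a * orbit_weight n p (\<lambda>i. s i (a i))))"
    using 0 by simp
  also have "\<dots> = (\<Sum>s\<in>?S. \<Sum>a\<in>Fix p.
      f a * orbit_weight n p (\<lambda>i. (scale s i)\<^sup>2 * s i (a i) * cnj (s i (b i))))"
    by (simp add: orbit_weight_mult sum_distrib_left mult_ac)
  also have "\<dots> = (\<Sum>a\<in>Fix p. \<Sum>s\<in>?S.
      f a * orbit_weight n p (\<lambda>i. (scale s i)\<^sup>2 * s i (a i) * cnj (s i (b i))))"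
    by (rule sum.swap)
  also have "\<dots> = (\<Sum>a\<in>Fix p. f a * (if a = b then 1 else 0))"
    by (rule sum.cong) (simp_all only: sum_distrib_left[symmetric] sum_scale_character[OF p _ b])
  also have "\<dots> = f b" using b by (simp add: finite_inv_labels if_distrib cong: if_cong)
  finally show ?thesis by simp
qed

lemma deconf_exists:
  assumes p: "p permutes {..<n}" and b: "b \<in> Fix p"
  shows "\<exists>d. is_deconf C n p b d"
proof -
  \<comment> \<open>The entry of \<open>b\<close> on an orbit is placed on its least layer, with
    units on the others, so the product along the orbit is that entry. The confinement is checked
    through evaluations rather than fusion coefficients.\<close>
  define a0 where "a0 i = (if i < n \<and> i = Min (orbit_of p i) then b i else unit C)" for i
  define d where "d = basis_elem a0"
  have a0: "a0 \<in> anyons C n" using b by (auto simp: a0_def anyons_def inv_labels_def labels_def)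
  have zero: "(\<Sum>c\<in>Fix p. of_int (conf_elem C n p d c - (if c = b then 1 else 0)) *
      orbit_weight n p (\<lambda>i. s i (c i))) = 0" if s: "s \<in> inv_labels n p (characters C) (\<lambda>_. 0)" for s
  proof -
    have s': "s \<in> Lab" "\<And>i. s (p i) = s i" using s by (auto simp: inv_labels_def)
    have "hat s d = (\<Sum>a\<in>anyons C n. if a = a0 then \<Prod>i<n. s i (a0 i) else 0)"
      unfolding hat_def by (rule sum.cong) (auto simp: d_def basis_elem_def)
    also have "\<dots> = (\<Prod>i<n. s i (a0 i))" using a0 by simp
    also have "\<dots> = (\<Prod>Q\<in>orbits n p. \<Prod>i\<in>Q. s i (a0 i))" by (rule prod_over_orbits[OF p])
    also have "\<dots> = orbit_weight n p (\<lambda>i. s i (b i))"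
      unfolding orbit_weight_def
    proof (rule prod.cong[OF refl])
      fix Q assume Q: "Q \<in> orbits n p"
      have "(\<Prod>i\<in>Q. s i (a0 i)) = (\<Prod>i\<in>Q. if i = Min Q then s (Min Q) (b (Min Q)) else 1)"
      proof (rule prod.cong[OF refl])
        fix i assume i: "i \<in> Q"
        then have "orbit_of p i = Q" "i < n" using orbit_eq_orbit_of[OF p Q] orbit_less[OF p Q] by auto
        then show "s i (a0 i) = (if i = Min Q then s (Min Q) (b (Min Q)) else 1)"
          using Lab_character[OF s'(1)] by (auto simp: a0_def)
      qed
      then show "(\<Prod>i\<in>Q. s i (a0 i)) = s (Min Q) (b (Min Q))"
        using orbit_finite[OF p Q] orbit_Min_in[OF p Q] by simp
    qed
    finally have "(\<Sum>c\<in>Fix p. of_int (conf_elem C n p d c) * orbit_weight n p (\<lambda>i. s i (c i))) =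
        orbit_weight n p (\<lambda>i. s i (b i))"
      using sum_conf_elem[OF p s'] by simp
    moreover have "(\<Sum>c\<in>Fix p. of_int (if c = b then 1 else 0) * orbit_weight n p (\<lambda>i. s i (c i))) =
        orbit_weight n p (\<lambda>i. s i (b i))"
    proof -
      have "(\<Sum>c\<in>Fix p. of_int (if c = b then 1 else 0) * orbit_weight n p (\<lambda>i. s i (c i))) =
          (\<Sum>c\<in>Fix p. if c = b then orbit_weight n p (\<lambda>i. s i (b i)) else 0)"
        by (rule sum.cong) auto
      then show ?thesis using b by (simp add: finite_inv_labels)
    qed
    ultimately show ?thesis by (simp add: left_diff_distrib sum_subtractf)
  qed
  have on: "conf_elem C n p d c = (if c = b then 1 else 0)" if c: "c \<in> Fix p" for c
  proof -
    have "of_int (conf_elem C n p d c - (if c = b then 1 else 0)) = (0::complex)"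
      by (rule weights_independent[OF p c zero])
    then show ?thesis by (simp only: of_int_eq_0_iff right_minus_eq)
  qed
  have "conf_elem C n p d = (\<lambda>c. if c = b then 1 else 0)"
  proof
    fix c
    show "conf_elem C n p d c = (if c = b then 1 else 0)"
    proof (cases "c \<in> Fix p")
      case False
      then have "\<not> (c \<in> anyons C n \<and> fixed_by n p c)"
        using fixed_by_iff[OF p, of c "Irr C" "unit C"] by (auto simp: inv_labels_def anyons_labels)
      then show ?thesis using False b by (auto simp: conf_elem_def)
    qed (rule on)
  qed
  then have "is_deconf C n p b d" using a0 by (auto simp: is_deconf_def d_def basis_elem_def)
  then show ?thesis by blast
qed

lemma is_deconf_deconf: "p permutes {..<n} \<Longrightarrow> b \<in> Fix p \<Longrightarrow> is_deconf C n p b (deconf C n p b)"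
  unfolding deconf_def by (rule someI_ex[of "is_deconf C n p b"]) (rule deconf_exists)

text \<open>All deconfinements of \<open>b\<close> have the same evaluation at
  \<open>p\<close>-invariant labelings, so the choice made in \<open>deconf\<close> does not matter
  there.\<close>

lemma hat_deconf:
  assumes p: "p permutes {..<n}" and b: "b \<in> Fix p" and s: "s \<in> Lab" "\<And>i. s (p i) = s i"
  shows "hat s (deconf C n p b) = orbit_weight n p (\<lambda>i. s i (b i))"
proof -
  have "hat s (deconf C n p b) = (\<Sum>c\<in>Fix p. of_int (if c = b then 1 else 0) * orbit_weight n p (\<lambda>i. s i (c i)))"
    using sum_conf_elem[OF p s, of "deconf C n p b"] is_deconf_deconf[OF p b] by (simp add: is_deconf_def)
  also have "\<dots> = (\<Sum>c\<in>Fix p. if c = b then orbit_weight n p (\<lambda>i. s i (b i)) else 0)"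
    by (rule sum.cong) auto
  finally show ?thesis using b by (simp add: finite_inv_labels)
qed

end

section \<open>The defect fusion ring\<close>

context fusion_layers
begin

text \<open>The rescaled basis element as a function of labelings: the factors
  \<open>scale s i\<close> and the denominator absorb the nonzero values of \<open>F\<close>, and
  the extension by 0 accounts for its zeros.\<close>

definition symbol :: "(nat \<Rightarrow> nat) \<times> (nat \<Rightarrow> 'a) \<Rightarrow> (nat \<Rightarrow> 'a \<Rightarrow> complex) \<Rightarrow> complex" where
  "symbol x s = (if \<forall>i. s (fst x i) = s i
     then orbit_weight n (fst x) (\<lambda>i. scale s i * s i (snd x i)) / prod (scale s) {..<n} else 0)"

text \<open>The defect product becomes the pointwise product of symbols. Off the
  \<open>r \<circ> p\<close>-invariant labelings both sides vanish, since invariance under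
  \<open>r\<close> and \<open>p\<close> implies invariance under \<open>r \<circ> p\<close>.\<close>

lemma sum_dN_symbol:
  assumes r: "r permutes {..<n}" and a: "a \<in> Fix r" and p: "p permutes {..<n}" and b: "b \<in> Fix p"
    and s: "s \<in> Lab"
  shows "(\<Sum>c\<in>Fix (r \<circ> p). of_int (dN C n (r, a) (p, b) (r \<circ> p, c)) * symbol (r \<circ> p, c) s) =
    symbol (r, a) s * symbol (p, b) s"
proof (cases "\<forall>i. s ((r \<circ> p) i) = s i")
  case inv: True
  let ?x = "tprod C n (tprod C n (deconf C n r a) (deconf C n p b)) (Fmap C n r p)"
  let ?W = "prod (scale s) {..<n}"
  have rp: "(r \<circ> p) permutes {..<n}" by (rule permutes_compose[OF p r])
  have W: "?W \<noteq> 0" using scale_nonzero[OF s] by simp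
  have "(\<Sum>c\<in>Fix (r \<circ> p). of_int (dN C n (r, a) (p, b) (r \<circ> p, c)) * symbol (r \<circ> p, c) s) =
      (\<Sum>c\<in>Fix (r \<circ> p). of_int (conf_elem C n (r \<circ> p) ?x c) * orbit_weight n (r \<circ> p) (\<lambda>i. s i (c i))) *
      (orbit_weight n (r \<circ> p) (scale s) / ?W)"
    unfolding sum_distrib_right
    by (rule sum.cong[OF refl]) (use inv in \<open>simp add: dN_def symbol_def orbit_weight_mult\<close>)
  also have "\<dots> = hat s ?x * (orbit_weight n (r \<circ> p) (scale s) / ?W)"
    using sum_conf_elem[OF rp s] inv by simp
  also have "\<dots> = hat s (deconf C n r a) * hat s (deconf C n p b) *
      (hat s (Fmap C n r p) * orbit_weight n (r \<circ> p) (scale s) * ?W) / ?W\<^sup>2"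
    using W by (simp add: hat_tprod[OF s] power2_eq_square)
  also have "\<dots> = symbol (r, a) s * symbol (p, b) s"
  proof (cases "\<forall>i. s (r i) = s i")
    case True
    then have sp: "s (p i) = s i" for i using inv by (metis comp_apply)
    have "hat s (deconf C n r a) = orbit_weight n r (\<lambda>i. s i (a i))"
      "hat s (deconf C n p b) = orbit_weight n p (\<lambda>i. s i (b i))"
      using hat_deconf[OF r a s] hat_deconf[OF p b s] True sp by auto
    then show ?thesis
      using hat_Fmap[OF r p s] inv True sp
      by (simp add: symbol_def orbit_weight_mult power2_eq_square)
  next
    case False
    \<comment> \<open>Here the evaluations of the chosen deconfinements are not controlled, but the
      evaluation of \<open>F\<close> is zero.\<close>
    have "hat s (Fmap C n r p) * orbit_weight n (r \<circ> p) (scale s) * ?W =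
        (if \<forall>i. s (r i) = s i then orbit_weight n r (scale s) * orbit_weight n p (scale s) else 0)"
      by (rule hat_Fmap[OF r p s]) (use inv in blast)
    also have "\<dots> = 0" by (rule if_not_P[OF False])
    finally have "hat s (Fmap C n r p) * orbit_weight n (r \<circ> p) (scale s) * ?W = 0" .
    moreover have "symbol (r, a) s = 0" unfolding symbol_def fst_conv if_not_P[OF False] ..
    ultimately show ?thesis by (simp only: mult_zero_right mult_zero_left div_0)
  qed
  finally show ?thesis .
next
  case False
  then have "\<not> (\<forall>i. s (r i) = s i) \<or> \<not> (\<forall>i. s (p i) = s i)" by (metis comp_apply)
  then have "symbol (r, a) s * symbol (p, b) s = 0"
    unfolding symbol_def fst_conv by (elim disjE) (simp_all only: if_False mult_zero_left mult_zero_right)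
  moreover have "symbol (r \<circ> p, c) s = 0" for c unfolding symbol_def fst_conv if_not_P[OF False] ..
  ultimately show ?thesis by simp
qed

text \<open>On \<open>p\<close>-invariant labelings a symbol is an orbit weight times the nonzero
  number \<open>?k\<close>, which does not depend on the anyon.\<close>

lemma symbols_independent:
  fixes f g :: "(nat \<Rightarrow> 'a) \<Rightarrow> int"
  assumes p: "p permutes {..<n}" and b: "b \<in> Fix p"
    and eq: "\<And>s. s \<in> Lab \<Longrightarrow> (\<Sum>a\<in>Fix p. of_int (f a) * symbol (p, a) s) =
      (\<Sum>a\<in>Fix p. of_int (g a) * symbol (p, a) s)"
  shows "f b = g b"
proof -
  have "of_int (f b - g b) = (0::complex)"
  proof (rule weights_independent[OF p b])
    fix s assume s: "s \<in> inv_labels n p (characters C) (\<lambda>_. 0)"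
    then have s': "s \<in> Lab" "\<forall>i. s (p i) = s i" by (auto simp: inv_labels_def)
    let ?k = "orbit_weight n p (scale s) / prod (scale s) {..<n}"
    have k: "?k \<noteq> 0"
      using orbit_weight_scale_nonzero[OF p s'(1)] scale_nonzero[OF s'(1)] by simp
    have "(\<Sum>a\<in>Fix p. of_int (f a - g a) * orbit_weight n p (\<lambda>i. s i (a i))) * ?k =
        (\<Sum>a\<in>Fix p. of_int (f a) * symbol (p, a) s) - (\<Sum>a\<in>Fix p. of_int (g a) * symbol (p, a) s)"
      unfolding sum_distrib_right sum_subtractf[symmetric]
      by (rule sum.cong[OF refl])
         (use s'(2) in \<open>simp add: symbol_def orbit_weight_mult diff_divide_distrib algebra_simps\<close>)
    then show "(\<Sum>a\<in>Fix p. of_int (f a - g a) * orbit_weight n p (\<lambda>i. s i (a i))) = 0"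
      using eq[OF s'(1)] k by simp
  qed
  then show ?thesis by simp
qed

text \<open>Structure constants are recognised by the pointwise product that they reproduce; the
  chosen deconfinements and the list of transpositions need not be inspected.\<close>

lemma dN_eqI:
  assumes r: "r permutes {..<n}" and a: "a \<in> Fix r" and p: "p permutes {..<n}" and b: "b \<in> Fix p"
    and c: "c \<in> Fix (r \<circ> p)"
    and f: "\<And>s. s \<in> Lab \<Longrightarrow> (\<Sum>c\<in>Fix (r \<circ> p). of_int (f c) * symbol (r \<circ> p, c) s) =
      symbol (r, a) s * symbol (p, b) s"
  shows "dN C n (r, a) (p, b) (r \<circ> p, c) = f c"
proof -
  let ?g = "\<lambda>c. dN C n (r, a) (p, b) (r \<circ> p, c)"
  have "(\<Sum>c\<in>Fix (r \<circ> p). of_int (?g c) * symbol (r \<circ> p, c) s) =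
      (\<Sum>c\<in>Fix (r \<circ> p). of_int (f c) * symbol (r \<circ> p, c) s)" if "s \<in> Lab" for s
    using sum_dN_symbol[OF r a p b that] f[OF that] by simp
  from symbols_independent[of _ _ ?g f, OF permutes_compose[OF p r] c this] show ?thesis .
qed

lemma finite_Fix [simp]: "finite (Fix p)"
  by (simp add: finite_inv_labels)

lemma dN_other: "q \<noteq> r \<circ> p \<Longrightarrow> dN C n (r, a) (p, b) (q, c) = 0"
  by (simp add: dN_def)

lemma dbasis_perm: "(p, a) \<in> dbasis C n \<Longrightarrow> p permutes {..<n}"
  by (simp add: dbasis_iff)

lemma support_dN:
  assumes "(r, a) \<in> dbasis C n" "(p, b) \<in> dbasis C n"
  shows "{l \<in> dbasis C n. dN C n (r, a) (p, b) l \<noteq> 0} \<subseteq> Pair (r \<circ> p) ` Fix (r \<circ> p)"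
proof
  fix l assume l: "l \<in> {l \<in> dbasis C n. dN C n (r, a) (p, b) l \<noteq> 0}"
  obtain q c where q: "l = (q, c)" by (cases l)
  then have "q = r \<circ> p" using l dN_other[of q r p] by auto
  then show "l \<in> Pair (r \<circ> p) ` Fix (r \<circ> p)" using l q by (auto simp: dbasis_iff)
qed

lemma sum_support_dN:
  assumes "(r, a) \<in> dbasis C n" "(p, b) \<in> dbasis C n"
  shows "(\<Sum>l\<in>{l \<in> dbasis C n. dN C n (r, a) (p, b) l \<noteq> 0}. dN C n (r, a) (p, b) l * G l) =
    (\<Sum>c\<in>Fix (r \<circ> p). dN C n (r, a) (p, b) (r \<circ> p, c) * G (r \<circ> p, c))"
proof -
  have rp: "(r \<circ> p) permutes {..<n}" using assms by (auto intro: permutes_compose dbasis_perm)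
  have "(\<Sum>l\<in>{l \<in> dbasis C n. dN C n (r, a) (p, b) l \<noteq> 0}. dN C n (r, a) (p, b) l * G l) =
      (\<Sum>l\<in>Pair (r \<circ> p) ` Fix (r \<circ> p). dN C n (r, a) (p, b) l * G l)"
    by (rule sum.mono_neutral_left) (use support_dN[OF assms] rp in \<open>auto simp: dbasis_iff\<close>)
  also have "\<dots> = (\<Sum>c\<in>Fix (r \<circ> p). dN C n (r, a) (p, b) (r \<circ> p, c) * G (r \<circ> p, c))"
    by (subst sum.reindex) (auto simp: inj_on_def)
  finally show ?thesis .
qed

section \<open>Nonnegativity, associativity and unit\<close>

lemma conf_nonneg: "0 \<le> conf C n p a b"
  unfolding conf_def by (rule prod_nonneg) simp

lemma tprod_nonneg: "(\<And>a. 0 \<le> x a) \<Longrightarrow> (\<And>a. 0 \<le> y a) \<Longrightarrow> 0 \<le> tprod C n x y c"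
  unfolding tprod_def by (auto intro!: sum_nonneg mult_nonneg_nonneg prod_nonneg)

lemma Fprod_nonneg: "0 \<le> Fprod C n ts p c"
proof (induction ts arbitrary: c)
  case (Cons t ts)
  show ?case unfolding Fprod.simps
    by (rule tprod_nonneg) (use Cons in \<open>auto simp: Omega_def tunit_def\<close>)
qed (simp add: tunit_def)

lemma dN_nonneg:
  assumes "x \<in> dbasis C n" "y \<in> dbasis C n"
  shows "0 \<le> dN C n x y z"
proof -
  obtain r a p b q c where x: "x = (r, a)" and y: "y = (p, b)" and z: "z = (q, c)"
    by (cases x; cases y; cases z)
  have d: "0 \<le> deconf C n r a e" "0 \<le> deconf C n p b e" for e
    using is_deconf_deconf assms unfolding x y dbasis_iff is_deconf_def by blast+
  show ?thesis unfolding x y z dN_def Fmap_def conf_elem_def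
    by (auto intro!: sum_nonneg mult_nonneg_nonneg tprod_nonneg d Fprod_nonneg conf_nonneg)
qed

text \<open>In the sector of the threefold product both sides have as transform the pointwise
  product of the three symbols; in every other sector both are zero.\<close>

lemma dN_assoc:
  assumes i: "i \<in> dbasis C n" and j: "j \<in> dbasis C n" and k: "k \<in> dbasis C n" and m: "m \<in> dbasis C n"
  shows "(\<Sum>l\<in>{l \<in> dbasis C n. dN C n i j l \<noteq> 0}. dN C n i j l * dN C n l k m) =
    (\<Sum>l\<in>{l \<in> dbasis C n. dN C n j k l \<noteq> 0}. dN C n j k l * dN C n i l m)"
proof -
  obtain r a where ra: "i = (r, a)" by (cases i)
  obtain p b where pb: "j = (p, b)" by (cases j)
  obtain q c where qc: "k = (q, c)" by (cases k)
  obtain t d where td: "m = (t, d)" by (cases m)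
  have r: "r permutes {..<n}" "a \<in> Fix r" and p: "p permutes {..<n}" "b \<in> Fix p"
    and q: "q permutes {..<n}" "c \<in> Fix q" and t: "t permutes {..<n}" "d \<in> Fix t"
    using assms unfolding ra pb qc td dbasis_iff by auto
  have rp: "(r \<circ> p) permutes {..<n}" and pq: "(p \<circ> q) permutes {..<n}"
    using permutes_compose r p q by blast+
  let ?L = "\<lambda>e. \<Sum>l\<in>Fix (r \<circ> p). dN C n i j (r \<circ> p, l) * dN C n (r \<circ> p, l) k (t, e)"
  let ?R = "\<lambda>e. \<Sum>l\<in>Fix (p \<circ> q). dN C n j k (p \<circ> q, l) * dN C n i (p \<circ> q, l) (t, e)"
  have "?L d = ?R d"
  proof (cases "t = r \<circ> p \<circ> q")
    case True
    then have t2: "t = r \<circ> (p \<circ> q)" by (simp add: comp_assoc)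
    show ?thesis
    proof (rule symbols_independent[OF t])
      fix s assume s: "s \<in> Lab"
      have "(\<Sum>e\<in>Fix t. of_int (?L e) * symbol (t, e) s) = (\<Sum>l\<in>Fix (r \<circ> p). of_int (dN C n i j (r \<circ> p, l)) *
          (\<Sum>e\<in>Fix t. of_int (dN C n (r \<circ> p, l) k (t, e)) * symbol (t, e) s))"
        by (simp add: sum_distrib_left sum_distrib_right mult.assoc) (rule sum.swap)
      also have "\<dots> = (\<Sum>l\<in>Fix (r \<circ> p). of_int (dN C n i j (r \<circ> p, l)) * symbol (r \<circ> p, l) s) * symbol k s"
        unfolding sum_distrib_right
        by (rule sum.cong[OF refl]) (use sum_dN_symbol[OF rp _ q s] True in \<open>simp add: qc mult.assoc\<close>)
      also have "\<dots> = symbol i s * symbol j s * symbol k s"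
        using sum_dN_symbol[OF r p s] by (simp add: ra pb)
      finally have L: "(\<Sum>e\<in>Fix t. of_int (?L e) * symbol (t, e) s) = symbol i s * symbol j s * symbol k s" .
      have "(\<Sum>e\<in>Fix t. of_int (?R e) * symbol (t, e) s) = (\<Sum>l\<in>Fix (p \<circ> q). of_int (dN C n j k (p \<circ> q, l)) *
          (\<Sum>e\<in>Fix t. of_int (dN C n i (p \<circ> q, l) (t, e)) * symbol (t, e) s))"
        by (simp add: sum_distrib_left sum_distrib_right mult.assoc) (rule sum.swap)
      also have "\<dots> = (\<Sum>l\<in>Fix (p \<circ> q). of_int (dN C n j k (p \<circ> q, l)) * symbol (p \<circ> q, l) s) * symbol i s"
        unfolding sum_distrib_right
        by (rule sum.cong[OF refl]) (use sum_dN_symbol[OF r pq _ s] t2 in \<open>simp add: ra mult_ac\<close>)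
      also have "\<dots> = symbol i s * symbol j s * symbol k s"
        using sum_dN_symbol[OF p q s] by (simp add: pb qc mult_ac)
      finally show "(\<Sum>e\<in>Fix t. of_int (?L e) * symbol (t, e) s) = (\<Sum>e\<in>Fix t. of_int (?R e) * symbol (t, e) s)"
        using L by simp
    qed
  next
    case False
    then have "t \<noteq> r \<circ> (p \<circ> q)" by (simp add: comp_assoc)
    then show ?thesis using False dN_other[of t "r \<circ> p" q] dN_other[of t r "p \<circ> q"] unfolding ra qc by simp
  qed
  then show ?thesis
    using sum_support_dN[of r a p b "\<lambda>l. dN C n l k m"] sum_support_dN[of p b q c "\<lambda>l. dN C n i l m"] i j k
    unfolding ra pb qc td by simp
qed

lemma dunit_dbasis: "dunit C \<in> dbasis C n"
  using unit_anyon unfolding dunit_def dbasis_iff by (simp add: anyons_labels permutes_id)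

lemma symbol_dunit:
  assumes s: "s \<in> Lab"
  shows "symbol (dunit C) s = 1"
proof -
  have "prod (\<lambda>i. scale s i * s i (unit C)) {..<n} = prod (scale s) {..<n}"
    by (rule prod.cong) (use Lab_character[OF s] in auto)
  moreover have "prod (scale s) {..<n} \<noteq> 0" using scale_nonzero[OF s] by simp
  ultimately show ?thesis by (simp add: symbol_def dunit_def orbit_weight_id)
qed

lemma sum_delta_symbol:
  assumes "a \<in> Fix p"
  shows "(\<Sum>c\<in>Fix p. of_int (if a = c then 1 else 0) * symbol (p, c) s) = symbol (p, a) s"
proof -
  have "(\<Sum>c\<in>Fix p. of_int (if a = c then 1 else 0) * symbol (p, c) s) =
      (\<Sum>c\<in>Fix p. if a = c then symbol (p, a) s else 0)"
    by (rule sum.cong) auto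
  then show ?thesis using assms by simp
qed

lemma dN_unit:
  assumes i: "i \<in> dbasis C n" and k: "k \<in> dbasis C n"
  shows "dN C n (dunit C) i k = (if i = k then 1 else 0)" "dN C n i (dunit C) k = (if i = k then 1 else 0)"
proof -
  obtain r a where ra: "i = (r, a)" by (cases i)
  obtain p b where pb: "k = (p, b)" by (cases k)
  have r: "r permutes {..<n}" "a \<in> Fix r" and p: "b \<in> Fix p" using i k by (auto simp: ra pb dbasis_iff)
  have u: "id permutes {..<n}" "(\<lambda>_. unit C) \<in> Fix id"
    using dunit_dbasis unfolding dunit_def dbasis_iff by auto
  have "dN C n (id, \<lambda>_. unit C) (r, a) (p, b) = (if (r, a) = (p, b) then 1 else 0)"
  proof (cases "p = r")
    case True
    have "dN C n (id, \<lambda>_. unit C) (r, a) (id \<circ> r, b) = (if a = b then 1 else 0)"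
      by (rule dN_eqI[OF u r]) (use p True sum_delta_symbol[OF r(2)] symbol_dunit in \<open>simp_all add: dunit_def\<close>)
    then show ?thesis using True by simp
  qed (use dN_other[of p id r] in auto)
  moreover have "dN C n (r, a) (id, \<lambda>_. unit C) (p, b) = (if (r, a) = (p, b) then 1 else 0)"
  proof (cases "p = r")
    case True
    have "dN C n (r, a) (id, \<lambda>_. unit C) (r \<circ> id, b) = (if a = b then 1 else 0)"
      by (rule dN_eqI[OF r u]) (use p True sum_delta_symbol[OF r(2)] symbol_dunit in \<open>simp_all add: dunit_def\<close>)
    then show ?thesis using True by simp
  qed (use dN_other[of p r id] in auto)
  ultimately show "dN C n (dunit C) i k = (if i = k then 1 else 0)"
    "dN C n i (dunit C) k = (if i = k then 1 else 0)" unfolding ra pb dunit_def by simp_all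
qed

section \<open>Duality and the coefficient of the unit\<close>

definition ddual :: "(nat \<Rightarrow> nat) \<times> (nat \<Rightarrow> 'a) \<Rightarrow> (nat \<Rightarrow> nat) \<times> (nat \<Rightarrow> 'a)" where
  "ddual x = (inv (fst x), dual C \<circ> snd x)"

lemma Fix_Irr: "a \<in> Fix p \<Longrightarrow> a i \<in> Irr C"
  by (cases "i < n") (auto simp: inv_labels_def labels_def)

lemma dual_comp_Fix:
  assumes p: "p permutes {..<n}" and a: "a \<in> Fix p"
  shows "dual C \<circ> a \<in> Fix (inv p)"
  using a invariant_inv_iff[OF p, of a] by (auto simp: inv_labels_def labels_def)

lemma dual_comp_dual: "a \<in> Fix p \<Longrightarrow> dual C \<circ> (dual C \<circ> a) = a"
  using Fix_Irr by (auto simp: fun_eq_iff)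

lemma ddual_dbasis: "x \<in> dbasis C n \<Longrightarrow> ddual x \<in> dbasis C n"
  by (cases x) (simp add: ddual_def dbasis_iff permutes_inv dual_comp_Fix)

lemma ddual_ddual: "x \<in> dbasis C n \<Longrightarrow> ddual (ddual x) = x"
  by (cases x) (auto simp: ddual_def dbasis_iff dual_comp_dual permutes_inv_inv)

text \<open>Characters turn duals into conjugates, the scales are real, and a permutation and its
  inverse have the same orbits and the same invariant labelings.\<close>

lemma symbol_ddual:
  assumes x: "x \<in> dbasis C n" and s: "s \<in> Lab"
  shows "symbol (ddual x) s = cnj (symbol x s)"
proof -
  obtain p a where pa: "x = (p, a)" by (cases x)
  have p: "p permutes {..<n}" and a: "a \<in> Fix p" using x by (auto simp: pa dbasis_iff)
  have "orbit_weight n p (\<lambda>i. scale s i * s i (dual C (a i))) =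
      cnj (orbit_weight n p (\<lambda>i. scale s i * s i (a i)))"
    unfolding orbit_weight_def cnj_prod
  proof (rule prod.cong[OF refl])
    fix Q assume Q: "Q \<in> orbits n p"
    have "Min Q < n" by (rule orbit_less[OF p Q orbit_Min_in[OF p Q]])
    then show "scale s (Min Q) * s (Min Q) (dual C (a (Min Q))) =
        cnj (scale s (Min Q) * s (Min Q) (a (Min Q)))"
      using character_dual[OF Lab_character[OF s] Fix_Irr[OF a]] by simp
  qed
  then show ?thesis
    by (simp add: pa symbol_def ddual_def invariant_inv_iff[OF p] orbit_weight_inv[OF p])
qed

text \<open>Conjugation of the product formula leaves the integer structure constants alone.
  Pointwise multiplication commutes, so the reversal of factors is dictated by
  \<open>inv (r \<circ> p)\<close> alone.\<close>

lemma dN_ddual: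
  assumes i: "i \<in> dbasis C n" and j: "j \<in> dbasis C n" and k: "k \<in> dbasis C n"
  shows "dN C n i j (ddual k) = dN C n (ddual j) (ddual i) k"
proof -
  obtain r a where ra: "i = (r, a)" by (cases i)
  obtain p b where pb: "j = (p, b)" by (cases j)
  obtain q c where qc: "k = (q, c)" by (cases k)
  have r: "r permutes {..<n}" "a \<in> Fix r" and p: "p permutes {..<n}" "b \<in> Fix p"
    and q: "q permutes {..<n}" "c \<in> Fix q" using assms by (auto simp: ra pb qc dbasis_iff)
  let ?r = "inv r" and ?p = "inv p"
  have rp: "(r \<circ> p) permutes {..<n}" by (rule permutes_compose[OF p(1) r(1)])
  have pr: "(?p \<circ> ?r) permutes {..<n}" using permutes_compose permutes_inv r p by blast
  have inv: "inv (r \<circ> p) = ?p \<circ> ?r"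
    by (rule o_inv_distrib) (use r p permutes_bij in auto)
  show ?thesis
  proof (cases "q = ?p \<circ> ?r")
    case True
    then have iq: "inv q = r \<circ> p"
      using permutes_inv_inv[OF rp] inv by simp
    have "dN C n (?p, dual C \<circ> b) (?r, dual C \<circ> a) (?p \<circ> ?r, c) = dN C n (r, a) (p, b) (r \<circ> p, dual C \<circ> c)"
    proof (rule dN_eqI[OF permutes_inv[OF p(1)] dual_comp_Fix[OF p] permutes_inv[OF r(1)] dual_comp_Fix[OF r]])
      fix s assume s: "s \<in> Lab"
      have "(\<Sum>c\<in>Fix (?p \<circ> ?r). of_int (dN C n (r, a) (p, b) (r \<circ> p, dual C \<circ> c)) * symbol (?p \<circ> ?r, c) s) =
          (\<Sum>c\<in>Fix (r \<circ> p). of_int (dN C n (r, a) (p, b) (r \<circ> p, c)) * cnj (symbol (r \<circ> p, c) s))"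
      proof (rule sum.reindex_bij_witness[where i = "\<lambda>c. dual C \<circ> c" and j = "\<lambda>c. dual C \<circ> c"])
        fix c assume c: "c \<in> Fix (?p \<circ> ?r)"
        show "dual C \<circ> (dual C \<circ> c) = c" by (rule dual_comp_dual[OF c])
        show "dual C \<circ> c \<in> Fix (r \<circ> p)"
          using dual_comp_Fix[OF pr c] inv permutes_inv_inv[OF rp] by simp
        have "symbol (ddual (?p \<circ> ?r, c)) s = cnj (symbol (?p \<circ> ?r, c) s)"
          by (rule symbol_ddual) (use pr c s in \<open>simp_all add: dbasis_iff\<close>)
        then show "of_int (dN C n (r, a) (p, b) (r \<circ> p, dual C \<circ> c)) * cnj (symbol (r \<circ> p, dual C \<circ> c) s) =
            of_int (dN C n (r, a) (p, b) (r \<circ> p, dual C \<circ> c)) * symbol (?p \<circ> ?r, c) s"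
          using inv permutes_inv_inv[OF rp] by (simp add: ddual_def)
      next
        fix c assume c: "c \<in> Fix (r \<circ> p)"
        show "dual C \<circ> (dual C \<circ> c) = c" by (rule dual_comp_dual[OF c])
        show "dual C \<circ> c \<in> Fix (?p \<circ> ?r)" using dual_comp_Fix[OF rp c] inv by simp
      qed
      also have "\<dots> = cnj (\<Sum>c\<in>Fix (r \<circ> p). of_int (dN C n (r, a) (p, b) (r \<circ> p, c)) * symbol (r \<circ> p, c) s)"
        by (simp add: cnj_sum)
      also have "\<dots> = symbol (?p, dual C \<circ> b) s * symbol (?r, dual C \<circ> a) s"
        using sum_dN_symbol[OF r p s] symbol_ddual[OF i s] symbol_ddual[OF j s]
        by (simp add: ra pb ddual_def mult.commute)
      finally show "(\<Sum>c\<in>Fix (?p \<circ> ?r). of_int (dN C n (r, a) (p, b) (r \<circ> p, dual C \<circ> c)) * symbol (?p \<circ> ?r, c) s) =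
          symbol (?p, dual C \<circ> b) s * symbol (?r, dual C \<circ> a) s" .
    qed (use q True in simp)
    then show ?thesis using True iq by (simp add: ra pb qc ddual_def)
  next
    case False
    then have "inv q \<noteq> r \<circ> p" using inv permutes_inv_inv[OF q(1)] by metis
    then show ?thesis using False
      using dN_other[of "inv q" r p] dN_other[of q ?p ?r] by (simp add: ra pb qc ddual_def)
  qed
qed

text \<open>A Plancherel argument: summing the product of two symbols against the squared total
  scale gives the coefficient of the unit, and the same sum is the orthogonality relation between
  \<open>a\<close> and \<open>dual C \<circ> b\<close> over \<open>r\<close>-invariant
  labelings.\<close>

lemma dN_pairing:
  assumes i: "i \<in> dbasis C n" and j: "j \<in> dbasis C n"
  shows "dN C n i j (dunit C) = (if i = ddual j then 1 else 0)"
proof -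
  obtain r a where ra: "i = (r, a)" by (cases i)
  obtain p b where pb: "j = (p, b)" by (cases j)
  have r: "r permutes {..<n}" "a \<in> Fix r" and p: "p permutes {..<n}" "b \<in> Fix p"
    using assms by (auto simp: ra pb dbasis_iff)
  have u: "id permutes {..<n}" "(\<lambda>_. unit C) \<in> Fix id"
    using dunit_dbasis unfolding dunit_def dbasis_iff by auto
  show ?thesis
  proof (cases "r \<circ> p = id")
    case True
    have rp: "p = inv r"
      using True permutes_inv_o(2)[OF r(1)] by (metis comp_assoc comp_id id_comp)
    have pr: "r = inv p" using rp permutes_inv_inv[OF r(1)] by simp
    let ?N = "\<lambda>c. dN C n i j (id, c)" and ?W = "\<lambda>s. prod (scale s) {..<n}"
    have b': "dual C \<circ> b \<in> Fix r" unfolding pr by (rule dual_comp_Fix[OF p])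
    have "of_int (?N (\<lambda>_. unit C)) = (\<Sum>c\<in>Fix id. of_int (?N c) * (if c = (\<lambda>_. unit C) then 1 else 0))"
      using u(2) by (simp add: if_distrib finite_labels cong: if_cong)
    \<comment> \<open>The delta function at the unit is written by
      \<open>sum_scale_character\<close> for the identity permutation, where the characters of the
      unit are 1.\<close>
    also have "\<dots> = (\<Sum>c\<in>Fix id. of_int (?N c) * (\<Sum>s\<in>Lab. (?W s)\<^sup>2 * symbol (id, c) s))"
    proof (rule sum.cong[OF refl])
      fix c assume c: "c \<in> Fix id"
      have "(\<Sum>s\<in>Lab. (?W s)\<^sup>2 * symbol (id, c) s) =
          (\<Sum>s\<in>inv_labels n id (characters C) (\<lambda>_. 0).
            orbit_weight n id (\<lambda>i. (scale s i)\<^sup>2 * s i (c i) * cnj (s i (unit C))))"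
        unfolding inv_labels_id
      proof (rule sum.cong[OF refl])
        fix s assume s: "s \<in> Lab"
        have W: "?W s \<noteq> 0" using scale_nonzero[OF s] by simp
        have "orbit_weight n id (\<lambda>i. (scale s i)\<^sup>2 * s i (c i) * cnj (s i (unit C))) =
            (\<Prod>i<n. scale s i * (scale s i * s i (c i)))"
          unfolding orbit_weight_id
          by (rule prod.cong) (use Lab_character[OF s] in \<open>auto simp: power2_eq_square\<close>)
        then show "(?W s)\<^sup>2 * symbol (id, c) s =
            orbit_weight n id (\<lambda>i. (scale s i)\<^sup>2 * s i (c i) * cnj (s i (unit C)))"
          using W by (simp add: symbol_def orbit_weight_id prod.distrib power2_eq_square)
      qed
      also have "\<dots> = (if c = (\<lambda>_. unit C) then 1 else 0)" by (rule sum_scale_character[OF u(1) c u(2)])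
      finally show "of_int (?N c) * (if c = (\<lambda>_. unit C) then 1 else 0) =
          of_int (?N c) * (\<Sum>s\<in>Lab. (?W s)\<^sup>2 * symbol (id, c) s)" by simp
    qed
    also have "\<dots> = (\<Sum>c\<in>Fix id. \<Sum>s\<in>Lab. (?W s)\<^sup>2 * (of_int (?N c) * symbol (id, c) s))"
      by (simp add: sum_distrib_left mult_ac)
    also have "\<dots> = (\<Sum>s\<in>Lab. (?W s)\<^sup>2 * (\<Sum>c\<in>Fix id. of_int (?N c) * symbol (id, c) s))"
      by (subst sum.swap) (simp add: sum_distrib_left)
    also have "\<dots> = (\<Sum>s\<in>Lab. (?W s)\<^sup>2 * (symbol i s * symbol j s))"
      by (rule sum.cong[OF refl]) (use sum_dN_symbol[OF r p] True in \<open>simp add: ra pb\<close>)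
    \<comment> \<open>Labelings that are not \<open>r\<close>-invariant drop out because
      \<open>symbol i\<close> vanishes on them.\<close>
    also have "\<dots> = (\<Sum>s\<in>inv_labels n r (characters C) (\<lambda>_. 0). (?W s)\<^sup>2 * (symbol i s * symbol j s))"
      by (rule sum.mono_neutral_right) (auto simp: finite_labels inv_labels_def symbol_def ra)
    also have "\<dots> = (\<Sum>s\<in>inv_labels n r (characters C) (\<lambda>_. 0).
        orbit_weight n r (\<lambda>i. (scale s i)\<^sup>2 * s i (a i) * cnj (s i ((dual C \<circ> b) i))))"
    proof (rule sum.cong[OF refl])
      fix s assume s: "s \<in> inv_labels n r (characters C) (\<lambda>_. 0)"
      then have sL: "s \<in> Lab" and inv: "\<forall>i. s (r i) = s i" by (auto simp: inv_labels_def)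
      have W: "?W s \<noteq> 0" using scale_nonzero[OF sL] by simp
      have "orbit_weight n r (\<lambda>i. (scale s i)\<^sup>2 * s i (a i) * cnj (s i ((dual C \<circ> b) i))) =
          orbit_weight n r (\<lambda>i. scale s i * s i (a i) * (scale s i * s i (b i)))"
        unfolding orbit_weight_def
      proof (rule prod.cong[OF refl])
        fix Q assume Q: "Q \<in> orbits n r"
        have "Min Q < n" by (rule orbit_less[OF r(1) Q orbit_Min_in[OF r(1) Q]])
        then show "(scale s (Min Q))\<^sup>2 * s (Min Q) (a (Min Q)) * cnj (s (Min Q) ((dual C \<circ> b) (Min Q))) =
            scale s (Min Q) * s (Min Q) (a (Min Q)) * (scale s (Min Q) * s (Min Q) (b (Min Q)))"
          using character_dual[OF Lab_character[OF sL] Fix_Irr[OF p(2)]] by (simp add: power2_eq_square)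
      qed
      also have "\<dots> = (?W s)\<^sup>2 * (symbol i s * symbol j s)"
        using inv W invariant_inv_iff[OF r(1), of s]
        by (simp add: ra pb rp symbol_def orbit_weight_inv[OF r(1)]
            orbit_weight_mult[of n r "\<lambda>i. scale s i * s i (a i)"] power2_eq_square)
      finally show "(?W s)\<^sup>2 * (symbol i s * symbol j s) =
          orbit_weight n r (\<lambda>i. (scale s i)\<^sup>2 * s i (a i) * cnj (s i ((dual C \<circ> b) i)))" by simp
    qed
    also have "\<dots> = (if a = dual C \<circ> b then 1 else 0)" by (rule sum_scale_character[OF r b'])
    finally have "?N (\<lambda>_. unit C) = (if a = dual C \<circ> b then 1 else 0)"
      by (simp split: if_splits)
    then show ?thesis using pr by (simp add: ra pb ddual_def dunit_def)
  next
    case False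
    then have "r \<noteq> inv p" using permutes_inv_o(2)[OF p(1)] by auto
    then show ?thesis using dN_other[of id r p] False by (auto simp: ra pb ddual_def dunit_def)
  qed
qed

section \<open>Crossed commutativity\<close>

lemma conj_dbasis:
  assumes r: "r permutes {..<n}" and pb: "(p, b) \<in> dbasis C n"
  shows "(r \<circ> p \<circ> inv r, b \<circ> inv r) \<in> dbasis C n"
proof -
  have p: "p permutes {..<n}" "b \<in> Fix p" using pb by (auto simp: dbasis_iff)
  have "r \<circ> p \<circ> inv r permutes {..<n}"
    using permutes_compose permutes_inv r p by blast
  moreover have "b \<circ> inv r \<in> Fix (r \<circ> p \<circ> inv r)"
  proof -
    have "inv r i < n \<longleftrightarrow> i < n" for i
      using permutes_in_image[OF permutes_inv[OF r]] by simp
    then show ?thesis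
      using p(2) permutes_inverses[OF r] by (auto simp: inv_labels_def labels_def not_less[symmetric])
  qed
  ultimately show ?thesis by (simp add: dbasis_iff)
qed

text \<open>The symbol of \<open>(r, a)\<close> lives on \<open>r\<close>-invariant labelings, and
  there conjugating the other factor by \<open>r\<close> does not change its symbol. What remains is
  commutativity of the pointwise product.\<close>

lemma dN_crossed:
  assumes ra: "(r, a) \<in> dbasis C n" and pb: "(p, b) \<in> dbasis C n" and k: "k \<in> dbasis C n"
  shows "dN C n (r, a) (p, b) k =
    dN C n (r \<circ> p \<circ> inv r, b \<circ> inv r) (r, a) k"
proof -
  let ?r = "inv r"
  let ?p = "r \<circ> p \<circ> ?r" and ?b = "b \<circ> ?r"
  obtain q c where qc: "k = (q, c)" by (cases k)
  have r: "r permutes {..<n}" "a \<in> Fix r" and p: "p permutes {..<n}" "b \<in> Fix p" and q: "c \<in> Fix q"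
    and p': "?p permutes {..<n}" "?b \<in> Fix ?p"
    using ra pb k conj_dbasis[OF dbasis_perm[OF ra] pb] by (auto simp: qc dbasis_iff)
  have eq: "?p \<circ> r = r \<circ> p" using permutes_inv_o(2)[OF r(1)] by (simp add: comp_assoc)
  show ?thesis
  proof (cases "q = r \<circ> p")
    case True
    have "dN C n (r, a) (p, b) (r \<circ> p, c) = dN C n (?p, ?b) (r, a) (r \<circ> p, c)"
    proof (rule dN_eqI[OF r p])
      fix s assume s: "s \<in> Lab"
      have "symbol (?p, ?b) s * symbol (r, a) s = symbol (r, a) s * symbol (p, b) s"
      proof (cases "\<forall>i. s (r i) = s i")
        case inv: True
        then have inv': "s (?r i) = s i" for i using invariant_inv_iff[OF r(1), of s] by simp
        have iff: "(\<forall>i. s (?p i) = s i) \<longleftrightarrow> (\<forall>i. s (p i) = s i)"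
          using inv inv' permutes_inverses[OF r(1)] by (metis comp_apply)
        have w: "orbit_weight n ?p (\<lambda>i. scale s i * s i (?b i)) = orbit_weight n p (\<lambda>i. scale s i * s i (b i))"
          if sp: "\<forall>i. s (p i) = s i"
        proof -
          have "(\<lambda>i. scale s i * s i (b i)) \<circ> ?r = (\<lambda>i. scale s i * s i (?b i))"
            by (rule ext) (simp add: inv')
          moreover have "orbit_weight n ?p ((\<lambda>i. scale s i * s i (b i)) \<circ> ?r) =
              orbit_weight n p (\<lambda>i. scale s i * s i (b i))"
            by (rule orbit_weight_conj[OF r(1) p(1)]) (use sp p(2) in \<open>simp add: inv_labels_def\<close>)
          ultimately show ?thesis by simp
        qed
        have "symbol (?p, ?b) s = symbol (p, b) s"
          unfolding symbol_def fst_conv snd_conv iff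
          by (rule if_cong[OF refl _ refl]) (erule arg_cong[OF w])
        then show ?thesis by simp
      next
        case False
        then have "symbol (r, a) s = 0" unfolding symbol_def fst_conv if_not_P[OF False] by simp
        then show ?thesis by simp
      qed
      then show "(\<Sum>c\<in>Fix (r \<circ> p). of_int (dN C n (?p, ?b) (r, a) (r \<circ> p, c)) * symbol (r \<circ> p, c) s) =
          symbol (r, a) s * symbol (p, b) s"
        using sum_dN_symbol[OF p' r s] unfolding eq by simp
    qed (use q True in simp)
    then show ?thesis using True by (simp add: qc)
  next
    case False
    then show ?thesis
      unfolding qc using dN_other[of q r p a b c] dN_other[of q ?p r ?b a c] unfolding eq by simp
  qed
qed

lemma based_ring: "unital_based_Zplus_ring (dbasis C n) (dN C n) (dunit C)"
proof -
  have fin: "finite {k \<in> dbasis C n. dN C n i j k \<noteq> 0}" if "i \<in> dbasis C n" "j \<in> dbasis C n" for i j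
    using support_dN[of "fst i" "snd i" "fst j" "snd j"] that by (auto intro: finite_subset)
  have ex: "\<exists>inv. (\<forall>i\<in>dbasis C n. inv i \<in> dbasis C n \<and> inv (inv i) = i) \<and>
      (\<forall>i\<in>dbasis C n. \<forall>j\<in>dbasis C n. \<forall>k\<in>dbasis C n. dN C n i j (inv k) = dN C n (inv j) (inv i) k) \<and>
      (\<forall>i\<in>dbasis C n. \<forall>j\<in>dbasis C n. dN C n i j (dunit C) = (if i = inv j then 1 else 0))"
    by (rule exI[of _ ddual]) (simp add: ddual_dbasis ddual_ddual dN_ddual dN_pairing)
  show ?thesis
    unfolding unital_based_Zplus_ring_def
    by (intro conjI ballI; (rule ex dunit_dbasis | rule fin dN_nonneg dN_assoc dN_unit, assumption+))
qed

text \<open>The action of \<open>r\<close> permutes the basis, so reindexing the support of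
  \<open>Y\<close> reduces the claim to basis elements. \<open>act_elem\<close> pulls coefficients
  back along the inverse action.\<close>

lemma bmult_crossed:
  assumes ra: "(r, a) \<in> dbasis C n" and Y: "\<And>k. Y k \<noteq> 0 \<Longrightarrow> k \<in> dbasis C n"
  shows "bmult (dbasis C n) (dN C n) (basis_elem (r, a)) Y =
    bmult (dbasis C n) (dN C n) (act_elem r Y) (basis_elem (r, a))"
proof
  fix k
  let ?B = "dbasis C n" and ?r = "inv r"
  have r: "r permutes {..<n}" by (rule dbasis_perm[OF ra])
  have cancel: "?r \<circ> r = id" "r \<circ> ?r = id" using permutes_inv_o[OF r] by auto
  have cancel': "?r \<circ> (r \<circ> f) = f" "r \<circ> (?r \<circ> f) = f" for f :: "nat \<Rightarrow> nat"
    using cancel by (simp_all add: comp_assoc[symmetric])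
  have single: "{i \<in> ?B. basis_elem (r, a) i \<noteq> 0} = {(r, a)}" using ra by (auto simp: basis_elem_def)
  have "(\<Sum>j\<in>{j \<in> ?B. Y j \<noteq> 0}. Y j * dN C n (r, a) j k) =
      (\<Sum>i\<in>{i \<in> ?B. act_elem r Y i \<noteq> 0}. act_elem r Y i * dN C n i (r, a) k)" if k: "k \<in> ?B"
  proof (rule sum.reindex_bij_witness[where i = "\<lambda>(t, c). (?r \<circ> t \<circ> r, c \<circ> r)"
        and j = "\<lambda>(p, b). (r \<circ> p \<circ> ?r, b \<circ> ?r)"])
    fix x assume x: "x \<in> {j \<in> ?B. Y j \<noteq> 0}"
    obtain p b where pb: "x = (p, b)" by (cases x)
    have act: "act_elem r Y (r \<circ> p \<circ> ?r, b \<circ> ?r) = Y (p, b)"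
      by (simp add: act_elem_def comp_assoc cancel cancel')
    show "(case case x of (p, b) \<Rightarrow> (r \<circ> p \<circ> ?r, b \<circ> ?r) of (t, c) \<Rightarrow> (?r \<circ> t \<circ> r, c \<circ> r)) = x"
      by (simp add: pb comp_assoc cancel cancel')
    show "(case x of (p, b) \<Rightarrow> (r \<circ> p \<circ> ?r, b \<circ> ?r)) \<in> {i \<in> ?B. act_elem r Y i \<noteq> 0}"
      using x act conj_dbasis[OF r, of p b] by (simp add: pb)
    show "act_elem r Y (case x of (p, b) \<Rightarrow> (r \<circ> p \<circ> ?r, b \<circ> ?r)) *
        dN C n (case x of (p, b) \<Rightarrow> (r \<circ> p \<circ> ?r, b \<circ> ?r)) (r, a) k = Y x * dN C n (r, a) x k"
      using x act dN_crossed[OF ra _ k, of p b] by (simp add: pb)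
  next
    fix x assume x: "x \<in> {i \<in> ?B. act_elem r Y i \<noteq> 0}"
    obtain t c where tc: "x = (t, c)" by (cases x)
    show "(case case x of (t, c) \<Rightarrow> (?r \<circ> t \<circ> r, c \<circ> r) of (p, b) \<Rightarrow> (r \<circ> p \<circ> ?r, b \<circ> ?r)) = x"
      by (simp add: tc comp_assoc cancel cancel')
    \<comment> \<open>The preimage is a basis element because \<open>Y\<close> is nonzero on
      it.\<close>
    show "(case x of (t, c) \<Rightarrow> (?r \<circ> t \<circ> r, c \<circ> r)) \<in> {j \<in> ?B. Y j \<noteq> 0}"
      using x Y by (simp add: tc act_elem_def)
  qed
  then show "bmult ?B (dN C n) (basis_elem (r, a)) Y k = bmult ?B (dN C n) (act_elem r Y) (basis_elem (r, a)) k"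
    unfolding bmult_def single by (simp add: basis_elem_def)
qed

end

theorem theorem4p19:
  fixes C :: "'a fusion_data" and n :: nat
  assumes "mtc_fusion_rules C" and "n \<ge> 2"
  shows "unital_based_Zplus_ring (dbasis C n) (dN C n) (dunit C) \<and>
    (\<forall>r a Y. (r, a) \<in> dbasis C n \<longrightarrow> r \<in> perms n \<longrightarrow> (\<forall>k. Y k \<noteq> 0 \<longrightarrow> k \<in> dbasis C n) \<longrightarrow>
       bmult (dbasis C n) (dN C n) (basis_elem (r, a)) Y
       = bmult (dbasis C n) (dN C n) (act_elem r Y) (basis_elem (r, a)))"
proof -
  interpret fusion_layers C n by unfold_locales (rule assms(1))
  show ?thesis using based_ring bmult_crossed by blast
qed

end
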